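(* There is an absolute constant $h\in(0,1)$ such that the following holds. Given any number of nodes $K$ and any number of epochs $T$, there exist $K$ problem instances $\mathfrak{J}_1,\dots,\mathfrak{J}_K$ of the bandit problem with random walk feedback such that: (1) every instance has $K$ transient nodes; (2) in every instance all transient nodes are connected with the same probability, i.e. $m_{ij}=p$ for all $i,j\in[K]$ for a common $p>0$, and the one-step probability of hitting the absorbing node from any transient node is $1-Kp=h$, a constant independent of $T$ and $K$ (so the transition matrix $M$ is primitive with $\|M\|_\infty=1-h<1$); (3) for any policy $\pi$, $$\max_{k\in[K]}\mathbb{E}_{\mathfrak{J}_k,\pi}\big[\mathrm{Reg}(T)\big]\ \ge\ \frac{1}{8\sqrt2}\sqrt{KT},$$ where $\mathbb{E}_{\mathfrak{J}_k,\pi}$ is the expectation with respect to the distribution generated by instance $\mathfrak{J}_k$ and policy $\pi$.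
   Context: Bandit problem with random walk feedback. There are transient nodes $[K]=\{1,\dots,K\}$ and one absorbing node $*$. An instance consists of transition probabilities $m_{ij}$ ($i\in[K]$, $j\in[K]\cup\{*\}$, $\sum_j m_{ij}=1$), with $M=[m_{ij}]_{i,j\in[K]}$, and edge lengths taking values in $[0,1]$, which may be random, drawn from fixed distributions (depending on the edge and the instance), independently of all other randomness and independently across epochs. $\|M\|_\infty=\max_i\sum_{j\in[K]}|m_{ij}|$; $M$ is primitive if some power of $M$ has all entries positive. In each epoch $t=1,\dots,T$ the agent picks a node $J_t\in[K]$ and observes a random walk trajectory $\mathcal{P}_{t,J_t}=(X_{t,0},L_{t,1},X_{t,1},\dots,L_{t,H},X_{t,H})$, where $X_{t,0}=J_t$, the nodes form a Markov chain with transition probabilities $m_{ij}$, $X_{t,H}=*$ with $H$ the first hitting time of $*$, and $L_{t,k}$ is the edge length from $X_{t,k-1}$ to $X_{t,k}$. The reward is $\mathcal{L}(\mathcal{P}_{t,J_t})=\sum_{k=1}^H L_{t,k}$. A policy $\pi$ chooses $J_t$ (possibly with randomization) based on the trajectories observed in epochs $1,\dots,t-1$. With $\mu_j=\mathbb{E}[\mathcal{L}(\mathcal{P}_{t,j})]$, the regret is $\mathrm{Reg}(T)=\max_{i\in[K]}\sum_{t=1}^T\mu_i-\sum_{t=1}^T\mu_{J_t}$.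
   Formalization: Proved for 2 ≤ K ≤ 100T rather than for any K and T: the bound fails for K = 1 (the regret is zero) and for K ≥ 128T (the regret of uniformly random play is below T, hence below the claimed bound). *)

theory Defs
  imports "HOL-Probability.Probability" "HOL-Probability.SPMF" "Jordan_Normal_Form.Matrix"
begin

text \<open>
  The transient nodes are \<open>{..<K}\<close>. In the type \<^typ>\<open>nat option\<close> the transient node \<open>j\<close>
  is \<open>Some j\<close> and the absorbing node is \<open>None\<close>. The laws of the edge lengths are discrete,
  so that a policy can be an arbitrary (not necessarily measurable) function of the past.
\<close>

record rw_instance =
  nodes :: nat
  step_law :: "nat \<Rightarrow> nat option pmf"
  length_law :: "nat \<Rightarrow> nat option \<Rightarrow> real pmf"

definition all_nodes :: "nat \<Rightarrow> nat option set" where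
  "all_nodes K = insert None (Some ` {..<K})"

definition wf_instance :: "rw_instance \<Rightarrow> bool" where
  "wf_instance I \<longleftrightarrow> 0 < nodes I \<and>
     (\<forall>i<nodes I. set_pmf (step_law I i) \<subseteq> all_nodes (nodes I) \<and>
        (\<forall>x\<in>all_nodes (nodes I). set_pmf (length_law I i x) \<subseteq> {0..1}))"

definition trans_prob :: "rw_instance \<Rightarrow> nat \<Rightarrow> nat option \<Rightarrow> real" where
  "trans_prob I i x = pmf (step_law I i) x"

definition trans_mat :: "rw_instance \<Rightarrow> real mat" where
  "trans_mat I = mat (nodes I) (nodes I) (\<lambda>(i, j). trans_prob I i (Some j))"

definition norm_inf :: "real mat \<Rightarrow> real" where
  "norm_inf M = (MAX i\<in>{..<dim_row M}. \<Sum>j<dim_col M. \<bar>M $$ (i, j)\<bar>)"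

definition primitive_mat :: "real mat \<Rightarrow> bool" where
  "primitive_mat M \<longleftrightarrow> square_mat M \<and>
     (\<exists>n\<ge>1. \<forall>i<dim_row M. \<forall>j<dim_row M. (M ^\<^sub>m n) $$ (i, j) > 0)"


text \<open>
  Law of \<open>X\<^sub>1, \<dots>, X\<^sub>H\<close> for the chain started in \<open>i\<close>. Only finite paths carry mass, so mass
  is missing exactly when the absorbing node is missed with positive probability.
\<close>

partial_function (spmf) hitting_path ::
  "(nat \<Rightarrow> nat option pmf) \<Rightarrow> nat \<Rightarrow> nat option list spmf" where
  "hitting_path m i = bind_spmf (spmf_of_pmf (m i))
     (\<lambda>x. case x of
        None \<Rightarrow> return_spmf [None]
      | Some j \<Rightarrow> map_spmf ((#) (Some j)) (hitting_path m j))"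

text \<open>A trajectory is \<open>(X\<^sub>0, [(L\<^sub>1, X\<^sub>1), \<dots>, (L\<^sub>H, X\<^sub>H)])\<close> with \<open>X\<^sub>H = None\<close>.\<close>

type_synonym trajectory = "nat \<times> (real \<times> nat option) list"

fun attach_lengths ::
  "(nat \<times> nat option \<Rightarrow> real) \<Rightarrow> nat \<Rightarrow> nat option list \<Rightarrow> (real \<times> nat option) list" where
  "attach_lengths l i [] = []"
| "attach_lengths l i (None # xs) = [(l (i, None), None)]"
| "attach_lengths l i (Some j # xs) = (l (i, Some j), Some j) # attach_lengths l j xs"

text \<open>
  In every epoch each edge gets one length; the lengths of different edges are independent,
  and they are independent of the node path.
\<close>

definition edge_lengths :: "rw_instance \<Rightarrow> (nat \<times> nat option \<Rightarrow> real) pmf" where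
  "edge_lengths I =
     Pi_pmf ({..<nodes I} \<times> all_nodes (nodes I)) 0 (\<lambda>(i, x). length_law I i x)"

definition epoch_law :: "rw_instance \<Rightarrow> nat \<Rightarrow> trajectory spmf" where
  "epoch_law I i =
     bind_spmf (spmf_of_pmf (edge_lengths I)) (\<lambda>l.
     bind_spmf (hitting_path (step_law I) i) (\<lambda>xs.
     return_spmf (i, attach_lengths l i xs)))"

definition reward :: "trajectory \<Rightarrow> real" where
  "reward P = (\<Sum>(l, x)\<leftarrow>snd P. l)"

definition mean_reward :: "rw_instance \<Rightarrow> nat \<Rightarrow> real" where
  "mean_reward I j = (\<integral>P. reward P \<partial>measure_spmf (epoch_law I j))"


text \<open>
  A policy gives the conditional law of the next node given the trajectories observed so far.
  The past choices need not be recorded separately: they are the initial nodes \<open>fst P\<close>.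
\<close>

type_synonym policy = "trajectory list \<Rightarrow> nat pmf"

definition is_policy :: "nat \<Rightarrow> policy \<Rightarrow> bool" where
  "is_policy K \<pi> \<longleftrightarrow> (\<forall>hist. set_pmf (\<pi> hist) \<subseteq> {..<K})"

fun history_law :: "rw_instance \<Rightarrow> policy \<Rightarrow> nat \<Rightarrow> trajectory list spmf" where
  "history_law I \<pi> 0 = return_spmf []"
| "history_law I \<pi> (Suc t) =
     bind_spmf (history_law I \<pi> t) (\<lambda>hist.
     bind_spmf (spmf_of_pmf (\<pi> hist)) (\<lambda>j.
     bind_spmf (epoch_law I j) (\<lambda>P.
     return_spmf (hist @ [P]))))"

definition regret :: "rw_instance \<Rightarrow> nat \<Rightarrow> trajectory list \<Rightarrow> real" where
  "regret I T hist =
     (MAX i\<in>{..<nodes I}. \<Sum>t<T. mean_reward I i) - (\<Sum>t<T. mean_reward I (fst (hist ! t)))"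

definition expected_regret :: "rw_instance \<Rightarrow> policy \<Rightarrow> nat \<Rightarrow> real" where
  "expected_regret I \<pi> T = (\<integral>hist. regret I T hist \<partial>measure_spmf (history_law I \<pi> T))"

end

theory Submission
  imports Defs
begin

text \<open>
  All edge lengths vanish, except that the edge from \<open>i\<close> to the absorbing node carries a
  Bernoulli variable with parameter \<open>q i\<close>. An epoch then reveals exactly one Bernoulli sample, that
  of the last transient node visited, whatever node the walk was started from. The parameter is \<open>b\<close>
  at node \<open>k\<close> of the \<open>k\<close>-th instance and \<open>a\<close> at all other nodes, so that playing another node
  than \<open>k\<close> costs \<open>h * (b - a)\<close>.

  Compare with the base instance, in which all parameters are \<open>a\<close>. Summed over \<open>k\<close>, the relative
  entropies of the base history of length \<open>t\<close> with respect to that of the \<open>k\<close>-th instance are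
  \<open>t * kl(a, b)\<close>, since each sample concerns a single \<open>k\<close>. A linearised Pinsker inequality bounds
  the probability of playing \<open>k\<close> at time \<open>t\<close>, averaged over \<open>k\<close>, by
  \<open>1/K + sqrt (t * kl(a, b) / (2 * K))\<close>. For \<open>K < T\<close> take \<open>a, b = (1 \<mp> \<epsilon>) / 2\<close> with
  \<open>\<epsilon> = 3/8 * sqrt (K / T)\<close>. For \<open>T \<le> K\<close> take \<open>a = 0\<close>, \<open>b = 1\<close>, where the
  average is at most \<open>(1 + t) / K\<close>, as the histories differ only if \<open>k\<close> was sampled. The constant \<open>h\<close>
  has to be close to 1, since the gap is proportional to \<open>h\<close>: the case \<open>K = 2\<close> leaves little slack.
\<close>

section \<open>Expectations of discrete sub-probability measures\<close>

abbreviation expect :: "'a spmf \<Rightarrow> ('a \<Rightarrow> real) \<Rightarrow> real" where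
  "expect p f \<equiv> (\<integral>x. f x \<partial>measure_spmf p)"

lemma integrable_spmf_bounded:
  fixes f :: "'a \<Rightarrow> real"
  assumes "\<And>x. x \<in> set_spmf p \<Longrightarrow> \<bar>f x\<bar> \<le> B"
  shows "integrable (measure_spmf p) f"
  by (rule measure_spmf.integrable_const_bound[where B = B]) (use assms in auto)

lemma integrable_pmf_bounded:
  fixes f :: "'a \<Rightarrow> real"
  assumes "\<And>x. x \<in> set_pmf p \<Longrightarrow> \<bar>f x\<bar> \<le> B"
  shows "integrable (measure_pmf p) f"
  using integrable_spmf_bounded[of "spmf_of_pmf p" f B] assms by simp

lemma expect_cong:
  assumes "\<And>x. x \<in> set_spmf p \<Longrightarrow> f x = g x"
  shows "expect p f = expect p g"
  by (rule integral_cong_AE) (use assms in auto)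

lemma integral_pmf_cong:
  fixes f g :: "'a \<Rightarrow> real"
  assumes "\<And>x. x \<in> set_pmf p \<Longrightarrow> f x = g x"
  shows "(\<integral>x. f x \<partial>measure_pmf p) = (\<integral>x. g x \<partial>measure_pmf p)"
  by (rule integral_cong_AE) (use assms in \<open>auto simp: AE_measure_pmf_iff\<close>)

lemma expect_mono:
  assumes "\<And>x. x \<in> set_spmf p \<Longrightarrow> \<bar>f x\<bar> \<le> B" "\<And>x. x \<in> set_spmf p \<Longrightarrow> \<bar>g x\<bar> \<le> C"
    and "\<And>x. x \<in> set_spmf p \<Longrightarrow> f x \<le> g x"
  shows "expect p f \<le> expect p g"
  by (rule integral_mono_AE)
     (use assms in \<open>auto intro: integrable_spmf_bounded[where B = B] integrable_spmf_bounded[where B = C]\<close>)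

lemma integral_pmf_mono:
  fixes f g :: "'a \<Rightarrow> real"
  assumes "\<And>x. x \<in> set_pmf p \<Longrightarrow> \<bar>f x\<bar> \<le> B" "\<And>x. x \<in> set_pmf p \<Longrightarrow> \<bar>g x\<bar> \<le> C"
    and "\<And>x. x \<in> set_pmf p \<Longrightarrow> f x \<le> g x"
  shows "(\<integral>x. f x \<partial>measure_pmf p) \<le> (\<integral>x. g x \<partial>measure_pmf p)"
  using expect_mono[of "spmf_of_pmf p" f B g C] assms by simp

lemma expect_abs_le:
  assumes "\<And>x. x \<in> set_spmf p \<Longrightarrow> \<bar>f x\<bar> \<le> B" and "0 \<le> B"
  shows "\<bar>expect p f\<bar> \<le> B"
proof -
  have "\<bar>expect p f\<bar> \<le> expect p (\<lambda>x. \<bar>f x\<bar>)"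
    by (rule integral_abs_bound)
  also have "\<dots> \<le> expect p (\<lambda>x. B)"
    by (rule expect_mono[where B = B and C = B]) (use assms in auto)
  also have "\<dots> = B * weight_spmf p"
    by simp
  also have "\<dots> \<le> B"
    using assms(2) weight_spmf_le_1[of p] by (simp add: mult_left_le)
  finally show ?thesis .
qed

lemma integral_pmf_abs_le:
  fixes f :: "'a \<Rightarrow> real"
  assumes "\<And>x. x \<in> set_pmf p \<Longrightarrow> \<bar>f x\<bar> \<le> B" and "0 \<le> B"
  shows "\<bar>\<integral>x. f x \<partial>measure_pmf p\<bar> \<le> B"
  using expect_abs_le[of "spmf_of_pmf p" f B] assms by simp

lemma expect_bind:
  assumes "\<And>y. y \<in> set_spmf (bind_spmf p f) \<Longrightarrow> \<bar>g y\<bar> \<le> B"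
  shows "expect (bind_spmf p f) g = expect p (\<lambda>x. expect (f x) g)"
proof -
  \<comment> \<open>\<open>integral_bind\<close> asks for a bound on the whole type, while
    \<open>g\<close> is bounded on the support only, so \<open>g\<close> is cut off to 0 elsewhere.
    The bound becomes \<open>\<bar>B\<bar>\<close> because \<open>B\<close> may be negative when the
    support is empty.\<close>
  define g' where "g' y = (if y \<in> set_spmf (bind_spmf p f) then g y else 0)" for y
  have g': "\<bar>g' y\<bar> \<le> \<bar>B\<bar>" for y
    using assms[of y] by (auto simp: g'_def)
  have "expect (bind_spmf p f) g = expect (bind_spmf p f) g'"
    by (rule expect_cong) (simp add: g'_def)
  also have "\<dots> = expect p (\<lambda>x. expect (f x) g')"
    unfolding measure_spmf_bind o_def
    by (rule integral_bind[where K = "count_space UNIV" and B = "\<bar>B\<bar>" and B' = 1])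
       (use g' in \<open>auto simp: measure_spmf.emeasure_space_le_1 intro: finite_measure_spmf\<close>)
  also have "\<dots> = expect p (\<lambda>x. expect (f x) g)"
    by (intro expect_cong) (auto simp: g'_def set_bind_spmf Set.bind_def)
  finally show ?thesis .
qed

lemma expect_bind_pmf:
  assumes "\<And>y. y \<in> set_spmf (bind_pmf p f) \<Longrightarrow> \<bar>g y\<bar> \<le> B"
  shows "expect (bind_pmf p f) g = (\<integral>x. expect (f x) g \<partial>measure_pmf p)"
  using expect_bind[of "spmf_of_pmf p" f g B] assms by simp

lemma expect_return: "expect (return_spmf x) g = g x"
  by (simp flip: spmf_of_pmf_return_pmf)

lemma expect_map: "expect (map_spmf f p) g = expect p (\<lambda>x. g (f x))"
  unfolding measure_map_spmf_conv_distr by (subst integral_distr) auto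

section \<open>Laws of histories: recursion, support and total mass\<close>

lemma history_Suc:
  "history_law I \<pi> (Suc t) = bind_spmf (history_law I \<pi> t) (\<lambda>hist. bind_pmf (\<pi> hist)
     (\<lambda>j. map_spmf (\<lambda>P. hist @ [P]) (epoch_law I j)))"
  by (simp add: map_spmf_conv_bind_spmf)

declare history_law.simps(2) [simp del]

lemma set_history_Suc:
  "h \<in> set_spmf (history_law I \<pi> (Suc t)) \<longleftrightarrow>
   (\<exists>h' j P. h = h' @ [P] \<and> h' \<in> set_spmf (history_law I \<pi> t) \<and> j \<in> set_pmf (\<pi> h') \<and>
      P \<in> set_spmf (epoch_law I j))"
  by (auto simp: history_Suc set_bind_spmf bind_UNION set_spmf_bind_pmf simp del: split_paired_Ex)

lemma expect_history_Suc:
  assumes "\<And>hist. hist \<in> set_spmf (history_law I \<pi> (Suc t)) \<Longrightarrow> \<bar>g hist\<bar> \<le> B"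
  shows "expect (history_law I \<pi> (Suc t)) g =
    expect (history_law I \<pi> t) (\<lambda>hist. \<integral>j. expect (epoch_law I j) (\<lambda>P. g (hist @ [P])) \<partial>measure_pmf (\<pi> hist))"
  unfolding history_Suc
proof (subst expect_bind[where B = B], goal_cases)
  case (1 y)
  then show ?case
    using assms unfolding history_Suc by blast
next
  case 2
  show ?case
  proof (intro expect_cong, subst expect_bind_pmf[where B = B], goal_cases)
    case (1 hist y)
    then show ?case
      by (intro assms) (auto simp: history_Suc set_bind_spmf bind_UNION)
  qed (simp add: expect_map)
qed

lemma length_history:
  "hist \<in> set_spmf (history_law I \<pi> t) \<Longrightarrow> length hist = t"
  by (induction t arbitrary: hist) (auto simp: set_history_Suc)

lemma is_policyD: "is_policy K \<pi> \<Longrightarrow> j \<in> set_pmf (\<pi> hist) \<Longrightarrow> j < K"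
  by (auto simp: is_policy_def)

lemma set_history:
  assumes "is_policy K \<pi>" "\<And>j P. j < K \<Longrightarrow> P \<in> set_spmf (epoch_law I j) \<Longrightarrow> Q P"
  shows "hist \<in> set_spmf (history_law I \<pi> t) \<Longrightarrow> P \<in> set hist \<Longrightarrow> Q P"
proof (induction t arbitrary: hist)
  case (Suc t)
  then show ?case
    using assms(2) is_policyD[OF assms(1)] unfolding set_history_Suc by fastforce
qed simp

lemma lossless_history:
  assumes "is_policy K \<pi>" "\<And>j. j < K \<Longrightarrow> lossless_spmf (epoch_law I j)"
  shows "lossless_spmf (history_law I \<pi> t)"
proof (induction t)
  case (Suc t)
  then show ?case
    by (auto simp: history_Suc intro!: assms(2) is_policyD[OF assms(1)])
qed simp

lemma abs_sum_list_map_le: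
  fixes s :: "'a \<Rightarrow> real"
  assumes "\<And>x. \<bar>s x\<bar> \<le> B"
  shows "\<bar>sum_list (map s xs)\<bar> \<le> real (length xs) * B"
proof (induction xs)
  case (Cons x xs)
  then show ?case
    using assms[of x] by (simp add: algebra_simps)
qed simp

text \<open>Given the past, the law of the next epoch depends only on the node chosen, so an
  additive score can be averaged epoch by epoch. Losslessness keeps the score of the past from being
  scaled by a mass below 1. Applied once to the regret and once to the log-likelihood.\<close>

lemma expect_history_sum_list:
  assumes pol: "is_policy K \<pi>" and ll: "\<And>j. j < K \<Longrightarrow> lossless_spmf (epoch_law I j)"
    and s: "\<And>P. \<bar>s P\<bar> \<le> B"
  shows "expect (history_law I \<pi> T) (\<lambda>hist. sum_list (map s hist)) =
    (\<Sum>t<T. expect (history_law I \<pi> t) (\<lambda>hist. \<integral>j. expect (epoch_law I j) s \<partial>measure_pmf (\<pi> hist)))"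
proof (induction T)
  case 0
  then show ?case by (simp add: expect_return)
next
  case (Suc T)
  let ?H = "history_law I \<pi>"
  let ?e = "\<lambda>hist. \<integral>j. expect (epoch_law I j) s \<partial>measure_pmf (\<pi> hist)"
  have B: "0 \<le> B"
    using s[of undefined] by linarith
  have bnd: "\<bar>sum_list (map s hist)\<bar> \<le> real t * B" if "hist \<in> set_spmf (?H t)" for hist t
    using abs_sum_list_map_le[of s B hist] s length_history[OF that] by simp
  have E: "\<bar>expect (epoch_law I j) s\<bar> \<le> B" for j
    by (rule expect_abs_le[OF s B])
  have "expect (?H (Suc T)) (\<lambda>hist. sum_list (map s hist)) =
    expect (?H T) (\<lambda>hist. \<integral>j. expect (epoch_law I j) (\<lambda>P. sum_list (map s hist) + s P) \<partial>measure_pmf (\<pi> hist))"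
    by (subst expect_history_Suc[OF bnd]) auto
  also have "\<dots> = expect (?H T) (\<lambda>hist. \<integral>j. sum_list (map s hist) + expect (epoch_law I j) s \<partial>measure_pmf (\<pi> hist))"
  proof (intro expect_cong integral_pmf_cong)
    fix hist j
    assume "j \<in> set_pmf (\<pi> hist)"
    then have "lossless_spmf (epoch_law I j)"
      by (intro ll is_policyD[OF pol])
    then show "expect (epoch_law I j) (\<lambda>P. sum_list (map s hist) + s P) = sum_list (map s hist) + expect (epoch_law I j) s"
      by (subst Bochner_Integration.integral_add)
         (auto simp: lossless_spmf_def intro: integrable_spmf_bounded[OF s])
  qed
  also have "\<dots> = expect (?H T) (\<lambda>hist. sum_list (map s hist) + ?e hist)"
    by (intro expect_cong, subst Bochner_Integration.integral_add)
       (auto intro: integrable_pmf_bounded[OF E])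
  also have "\<dots> = expect (?H T) (\<lambda>hist. sum_list (map s hist)) + expect (?H T) ?e"
    by (intro Bochner_Integration.integral_add integrable_spmf_bounded[OF bnd]
          integrable_spmf_bounded[OF integral_pmf_abs_le[OF E B]])
  finally show ?case
    using Suc.IH by simp
qed

section \<open>Product weights along a history\<close>

lemma prod_list_bounds:
  fixes w :: "'a \<Rightarrow> real"
  assumes "\<And>x. 0 \<le> w x" "\<And>x. w x \<le> C"
  shows "0 \<le> prod_list (map w xs)" "prod_list (map w xs) \<le> C ^ length xs"
proof -
  show *: "0 \<le> prod_list (map w xs)"
    by (induction xs) (auto simp: assms(1))
  show "prod_list (map w xs) \<le> C ^ length xs"
  proof (induction xs)
    case (Cons x xs)
    have "0 \<le> prod_list (map w xs)"
      by (induction xs) (auto simp: assms(1))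
    moreover have "0 \<le> C"
      using assms order_trans by blast
    ultimately show ?case
      using Cons by (auto intro!: mult_mono assms)
  qed simp
qed

text \<open>
  Only an inequality between the densities is assumed, so that \<open>w\<close> may vanish where \<open>I'\<close> is not
  absolutely continuous with respect to \<open>I\<close>.
\<close>

lemma history_change_of_measure:
  assumes pol: "is_policy K \<pi>" and w: "\<And>P. 0 \<le> w P" "\<And>P. w P \<le> C"
    and epoch: "\<And>j g B. j < K \<Longrightarrow> (\<And>P. 0 \<le> g P) \<Longrightarrow> (\<And>P. g P \<le> B) \<Longrightarrow>
      expect (epoch_law I j) (\<lambda>P. w P * g P) \<le> expect (epoch_law I' j) g"
    and g: "\<And>hist. 0 \<le> g hist" "\<And>hist. g hist \<le> B"
  shows "expect (history_law I \<pi> t) (\<lambda>hist. prod_list (map w hist) * g hist) \<le> expect (history_law I' \<pi> t) g"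
  using g
proof (induction t arbitrary: g B)
  case 0
  then show ?case by (simp add: expect_return)
next
  case (Suc t)
  let ?W = "\<lambda>hist. prod_list (map w hist)"
  let ?e = "\<lambda>I hist f. \<integral>j. expect (epoch_law I j) f \<partial>measure_pmf (\<pi> hist)"
  have C: "0 \<le> C" and B: "0 \<le> B"
    using w[of undefined] Suc.prems[of undefined] by linarith+
  have wg: "0 \<le> w P * g hist" "w P * g hist \<le> C * B" for P hist
    by (intro mult_nonneg_nonneg mult_mono w Suc.prems C)+
  have W: "0 \<le> ?W hist" "?W hist \<le> C ^ length hist" for hist
    by (rule prod_list_bounds; rule w)+
  \<comment> \<open>\<open>g'\<close> integrates out the last epoch under \<open>I\<close>. The
    induction hypothesis then moves the first \<open>t\<close> epochs to \<open>I'\<close>, and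
    \<open>epoch\<close> moves the last one.\<close>
  define g' where "g' hist = ?e I hist (\<lambda>P. w P * g (hist @ [P]))" for hist
  have g_abs: "\<bar>g hist\<bar> \<le> B" and wg_abs: "\<bar>w P * g hist\<bar> \<le> C * B" for P hist
    using wg Suc.prems by (simp_all only: abs_of_nonneg)
  have CB: "0 \<le> C * B"
    using C B by simp
  have ewg: "0 \<le> expect (epoch_law I j) (\<lambda>P. w P * g (hist @ [P]))"
            "\<bar>expect (epoch_law I j) (\<lambda>P. w P * g (hist @ [P]))\<bar> \<le> C * B"
            "\<bar>expect (epoch_law I' j) (\<lambda>P. g (hist @ [P]))\<bar> \<le> B" for j hist
    by (rule Bochner_Integration.integral_nonneg expect_abs_le g_abs wg_abs B CB wg(1))+
  have g': "0 \<le> g' hist" "\<bar>g' hist\<bar> \<le> C * B" for hist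
    unfolding g'_def by (rule Bochner_Integration.integral_nonneg integral_pmf_abs_le ewg CB)+
  have "expect (history_law I \<pi> (Suc t)) (\<lambda>hist. ?W hist * g hist) =
    expect (history_law I \<pi> t) (\<lambda>hist. ?W hist * g' hist)"
  proof (subst expect_history_Suc[where B = "C ^ Suc t * B"])
    fix hist
    assume "hist \<in> set_spmf (history_law I \<pi> (Suc t))"
    then have "?W hist \<le> C ^ Suc t"
      using length_history W(2)[of hist] by metis
    then show "\<bar>?W hist * g hist\<bar> \<le> C ^ Suc t * B"
      using W(1)[of hist] Suc.prems C by (auto simp: abs_mult intro!: mult_mono)
  qed (simp_all add: g'_def mult.assoc)
  also have "\<dots> \<le> expect (history_law I' \<pi> t) g'"
    using g' by (intro Suc.IH[where B = "C * B"]) (auto simp: abs_le_iff)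
  also have "\<dots> \<le> expect (history_law I' \<pi> t) (\<lambda>hist. ?e I' hist (\<lambda>P. g (hist @ [P])))"
  proof (rule expect_mono[where B = "C * B" and C = B])
    fix hist
    show "g' hist \<le> ?e I' hist (\<lambda>P. g (hist @ [P]))"
      unfolding g'_def
      by (rule integral_pmf_mono[where B = "C * B" and C = B])
         (use ewg Suc.prems in \<open>auto intro!: epoch is_policyD[OF pol]\<close>)
    show "\<bar>?e I' hist (\<lambda>P. g (hist @ [P]))\<bar> \<le> B"
      using ewg B by (intro integral_pmf_abs_le)
  qed (use g' in auto)
  also have "\<dots> = expect (history_law I' \<pi> (Suc t)) g"
    using Suc.prems by (subst expect_history_Suc[where B = B]) auto
  finally show ?case .
qed

section \<open>Instances that pay only on absorption\<close>

definition uniform_step :: "real \<Rightarrow> nat \<Rightarrow> nat option pmf" where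
  "uniform_step h K = bind_pmf (bernoulli_pmf h)
     (\<lambda>stop. if stop then return_pmf None else map_pmf Some (pmf_of_set {..<K}))"

definition terminal_reward_instance :: "real \<Rightarrow> nat \<Rightarrow> (nat \<Rightarrow> real) \<Rightarrow> rw_instance" where
  "terminal_reward_instance h K q = \<lparr>nodes = K, step_law = (\<lambda>_. uniform_step h K),
     length_law = (\<lambda>i x. if x = None then map_pmf of_bool (bernoulli_pmf (q i)) else return_pmf 0)\<rparr>"

lemma terminal_reward_instance_sel [simp]:
  "nodes (terminal_reward_instance h K q) = K"
  "step_law (terminal_reward_instance h K q) = (\<lambda>_. uniform_step h K)"
  "length_law (terminal_reward_instance h K q) =
     (\<lambda>i x. if x = None then map_pmf of_bool (bernoulli_pmf (q i)) else return_pmf 0)"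
  by (simp_all add: terminal_reward_instance_def)

fun exit_node :: "nat \<Rightarrow> nat option list \<Rightarrow> nat" where
  "exit_node i [] = i"
| "exit_node i (None # xs) = i"
| "exit_node i (Some j # xs) = exit_node j xs"

fun absorbed_path :: "nat \<Rightarrow> nat option list \<Rightarrow> bool" where
  "absorbed_path K [] \<longleftrightarrow> False"
| "absorbed_path K (None # xs) \<longleftrightarrow> xs = []"
| "absorbed_path K (Some j # xs) \<longleftrightarrow> j < K \<and> absorbed_path K xs"

definition last_node :: "trajectory \<Rightarrow> nat" where
  "last_node P = exit_node (fst P) (map snd (snd P))"

text \<open>Almost surely all lengths before the exit edge are 0, so an epoch is encoded by its node
  path and the single length \<open>c\<close> of the exit edge.\<close>

definition terminal_trajectory :: "nat \<Rightarrow> nat option list \<Rightarrow> real \<Rightarrow> trajectory" where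
  "terminal_trajectory i xs c = (i, attach_lengths (\<lambda>(i, x). if x = None then c else 0) i xs)"

lemma map_snd_attach_lengths: "absorbed_path K xs \<Longrightarrow> map snd (attach_lengths l i xs) = xs"
  by (induction l i xs rule: attach_lengths.induct) auto

lemma exit_node_less: "absorbed_path K xs \<Longrightarrow> i < K \<Longrightarrow> exit_node i xs < K"
  by (induction i xs rule: exit_node.induct) auto

lemma terminal_trajectory_simps:
  assumes "absorbed_path K xs"
  shows "fst (terminal_trajectory i xs c) = i"
    and "last_node (terminal_trajectory i xs c) = exit_node i xs"
    and "reward (terminal_trajectory i xs c) = c"
proof -
  show "reward (terminal_trajectory i xs c) = c"
    using assms unfolding terminal_trajectory_def reward_def
    by (induction i xs rule: exit_node.induct) auto
qed (use assms in \<open>simp_all add: terminal_trajectory_def last_node_def map_snd_attach_lengths\<close>)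

lemma attach_lengths_terminal:
  assumes "\<And>i j. i < K \<Longrightarrow> j < K \<Longrightarrow> l (i, Some j) = 0" "absorbed_path K xs" "i < K"
  shows "(i, attach_lengths l i xs) = terminal_trajectory i xs (l (exit_node i xs, None))"
  using assms(2,3) unfolding terminal_trajectory_def
  by (induction i xs rule: exit_node.induct) (auto simp: assms(1) cong: if_cong)

section \<open>The node path and its exit node\<close>

context
  fixes h :: real and K :: nat
  assumes h: "0 < h" "h < 1" and K: "0 < K"
begin

lemma nodes_nonempty: "{..<K} \<noteq> {}"
  using K by auto

lemma pmf_uniform_step:
  "pmf (uniform_step h K) None = h" "j < K \<Longrightarrow> pmf (uniform_step h K) (Some j) = (1 - h) / K"
  using h nodes_nonempty
  by (simp_all add: uniform_step_def pmf_bind pmf_map vimage_def measure_pmf_single)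

lemma set_uniform_step: "set_pmf (uniform_step h K) \<subseteq> all_nodes K"
  by (auto simp: uniform_step_def all_nodes_def set_pmf_of_set[OF nodes_nonempty] split: if_splits)

lemma integral_uniform_step:
  fixes f :: "nat option \<Rightarrow> real"
  shows "(\<integral>x. f x \<partial>measure_pmf (uniform_step h K)) = h * f None + (1 - h) / K * (\<Sum>j<K. f (Some j))"
proof -
  have fin: "finite (insert None (Some ` {..<K}))"
    by simp
  show ?thesis
    by (subst integral_measure_pmf_real[OF fin])
       (use set_uniform_step in \<open>auto simp: all_nodes_def pmf_uniform_step sum.reindex sum_distrib_left mult_ac\<close>)
qed

abbreviation "walk \<equiv> hitting_path (\<lambda>_. uniform_step h K)"

lemma expect_walk_unfold:
  assumes "\<And>xs. \<bar>\<psi> xs\<bar> \<le> B"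
  shows "expect (walk i) \<psi> = h * \<psi> [None] + (1 - h) / K * (\<Sum>j<K. expect (walk j) (\<lambda>xs. \<psi> (Some j # xs)))"
proof -
  have "expect (walk i) \<psi> = (\<integral>x. expect (case x of None \<Rightarrow> return_spmf [None]
      | Some j \<Rightarrow> map_spmf ((#) (Some j)) (walk j)) \<psi> \<partial>measure_pmf (uniform_step h K))"
    by (subst hitting_path.simps, subst bind_spmf_of_pmf, subst expect_bind_pmf[where B = B])
       (use assms in auto)
  then show ?thesis
    by (simp add: integral_uniform_step expect_return expect_map)
qed

text \<open>
  If \<open>\<psi>\<close> depends on the last transient node only, averaging the one-step equation over uniformly
  distributed starting nodes determines the average, and the equation then gives every value.
\<close>

lemma expect_walk:
  assumes bounded: "\<And>i xs. \<bar>\<psi> i xs\<bar> \<le> B" and stop: "\<And>i. \<psi> i [None] = \<phi> i"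
    and step: "\<And>i j xs. j < K \<Longrightarrow> \<psi> i (Some j # xs) = \<psi> j xs"
  shows "expect (walk i) (\<psi> i) = h * \<phi> i + (1 - h) / K * (\<Sum>j<K. \<phi> j)"
proof -
  let ?u = "\<lambda>i. expect (walk i) (\<psi> i)"
  have u: "?u i = h * \<phi> i + (1 - h) / K * sum ?u {..<K}" for i
    by (subst expect_walk_unfold[OF bounded]) (simp add: stop step)
  have "sum ?u {..<K} = h * sum \<phi> {..<K} + (1 - h) * sum ?u {..<K}"
    by (subst u) (use K in \<open>simp add: sum.distrib sum_distrib_left\<close>)
  then have "sum ?u {..<K} = sum \<phi> {..<K}"
    using h by (simp add: algebra_simps)
  then show ?thesis
    using u[of i] by simp
qed

text \<open>The constant 1 satisfies the hypotheses of \<open>expect_walk\<close>, which gives it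
  expectation 1. Thus \<open>0 < h\<close> rules out a defect of mass in the least solution that
  defines \<open>hitting_path\<close>.\<close>

lemma lossless_walk: "lossless_spmf (walk i)"
proof -
  have "expect (walk i) (\<lambda>_. 1) = h * 1 + (1 - h) / K * (\<Sum>j<K. 1)"
    by (rule expect_walk[where B = 1]) auto
  then show ?thesis
    using K by (simp add: lossless_spmf_def)
qed

text \<open>The indicator of \<open>absorbed_path\<close> does not change when a transient node is
  put in front, so \<open>expect_walk\<close> gives it expectation 1 as well. In a discrete measure
  a property of full probability holds on the whole support.\<close>

lemma set_walk: "xs \<in> set_spmf (walk i) \<Longrightarrow> absorbed_path K xs"
proof -
  assume xs: "xs \<in> set_spmf (walk i)"
  have "expect (walk i) (\<lambda>xs. of_bool (absorbed_path K xs)) = h * 1 + (1 - h) / K * (\<Sum>j<K. 1)"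
    by (rule expect_walk[where B = 1]) auto
  also have "\<dots> = 1"
    using K by simp
  finally have "expect (walk i) (indicator {xs. absorbed_path K xs}) = 1"
    by (simp add: indicator_def of_bool_def)
  then have 1: "measure (measure_spmf (walk i)) {xs. absorbed_path K xs} = 1"
    by simp
  have "emeasure (measure_spmf (walk i)) UNIV = 1"
    using lossless_walk[of i]
    by (simp add: lossless_spmf_def weight_spmf_def measure_spmf.emeasure_eq_measure)
  then interpret prob_space "measure_spmf (walk i)"
    by (intro prob_spaceI) (simp add: space_measure_spmf)
  have "AE xs in measure_spmf (walk i). absorbed_path K xs"
    using AE_in_set_eq_1[of "{xs. absorbed_path K xs}"] 1 by simp
  then show ?thesis
    using xs by simp
qed

text \<open>After one transient step the walk is at a uniform node and stays uniform until
  absorption. The exit node is therefore distributed as the mixture of the point mass at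
  \<open>i\<close>, with weight \<open>h\<close>, and the uniform law, with weight
  \<open>1 - h\<close>.\<close>

lemma expect_exit_node:
  assumes "i < K"
  shows "expect (walk i) (\<lambda>xs. \<phi> (exit_node i xs)) = h * \<phi> i + (1 - h) / K * (\<Sum>j<K. \<phi> j)"
proof -
  \<comment> \<open>\<open>expect_walk\<close> needs a bound valid for all paths. Cutting
    \<open>\<phi>\<close> off outside the transient nodes provides one and changes nothing on the
    support.\<close>
  define \<phi>' where "\<phi>' j = (if j < K then \<phi> j else 0)" for j
  have "expect (walk i) (\<lambda>xs. \<phi> (exit_node i xs)) = expect (walk i) (\<lambda>xs. \<phi>' (exit_node i xs))"
    by (rule expect_cong) (simp add: \<phi>'_def exit_node_less[OF set_walk assms])
  also have "\<dots> = h * \<phi>' i + (1 - h) / K * (\<Sum>j<K. \<phi>' j)"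
  proof (rule expect_walk[where B = "\<Sum>j<K. \<bar>\<phi> j\<bar>"])
    show "\<bar>\<phi>' (exit_node i xs)\<bar> \<le> (\<Sum>j<K. \<bar>\<phi> j\<bar>)" for i xs
      by (auto simp: \<phi>'_def intro: member_le_sum sum_nonneg)
  qed auto
  finally show ?thesis
    using assms by (simp add: \<phi>'_def)
qed

section \<open>Law of one epoch and mean rewards\<close>

context
  fixes q :: "nat \<Rightarrow> real"
begin

abbreviation "inst \<equiv> terminal_reward_instance h K q"

text \<open>The draw of the lengths commutes with the walk. Given the path, only the length of the
  exit edge remains visible, and its marginal under the product law is the Bernoulli law at the exit
  node.\<close>

lemma epoch_law_terminal:
  assumes "i < K"
  shows "epoch_law inst i = bind_spmf (walk i) (\<lambda>xs.
    map_spmf (\<lambda>b. terminal_trajectory i xs (of_bool b)) (spmf_of_pmf (bernoulli_pmf (q (exit_node i xs)))))"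
proof -
  let ?A = "{..<K} \<times> all_nodes K"
  have fin: "finite ?A"
    by (simp add: all_nodes_def)
  have zero: "l (i, Some j) = 0" if "l \<in> set_pmf (edge_lengths inst)" "i < K" "j < K" for l i j
  proof -
    have "l (i, Some j) \<in> set_pmf (map_pmf (\<lambda>l. l (i, Some j)) (edge_lengths inst))"
      using that by auto
    also have "map_pmf (\<lambda>l. l (i, Some j)) (edge_lengths inst) = return_pmf 0"
      unfolding edge_lengths_def using that fin
      by (simp add: Pi_pmf_component all_nodes_def)
    finally show ?thesis by simp
  qed
  have "epoch_law inst i = bind_spmf (walk i) (\<lambda>xs. bind_spmf (spmf_of_pmf (edge_lengths inst))
      (\<lambda>l. return_spmf (i, attach_lengths l i xs)))"
    unfolding epoch_law_def terminal_reward_instance_sel by (rule bind_commute_spmf)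
  also have "\<dots> = bind_spmf (walk i) (\<lambda>xs. bind_spmf (spmf_of_pmf (edge_lengths inst))
      (\<lambda>l. return_spmf (terminal_trajectory i xs (l (exit_node i xs, None)))))"
  proof (intro bind_spmf_cong refl)
    fix xs l
    assume "xs \<in> set_spmf (walk i)" "l \<in> set_spmf (spmf_of_pmf (edge_lengths inst))"
    then have "(i, attach_lengths l i xs) = terminal_trajectory i xs (l (exit_node i xs, None))"
      by (intro attach_lengths_terminal[where K = K] zero set_walk assms) auto
    then show "return_spmf (i, attach_lengths l i xs) = return_spmf (terminal_trajectory i xs (l (exit_node i xs, None)))"
      by simp
  qed
  also have "\<dots> = bind_spmf (walk i) (\<lambda>xs. map_spmf (terminal_trajectory i xs)
      (spmf_of_pmf (map_pmf (\<lambda>l. l (exit_node i xs, None)) (edge_lengths inst))))"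
    by (simp add: map_pmf_comp bind_pmf_return_spmf)
  also have "\<dots> = bind_spmf (walk i) (\<lambda>xs. map_spmf (terminal_trajectory i xs)
      (spmf_of_pmf (map_pmf of_bool (bernoulli_pmf (q (exit_node i xs))))))"
  proof (intro bind_spmf_cong refl)
    fix xs
    assume "xs \<in> set_spmf (walk i)"
    then have "exit_node i xs < K"
      by (intro exit_node_less set_walk assms)
    then have "map_pmf (\<lambda>l. l (exit_node i xs, None)) (edge_lengths inst) =
        map_pmf of_bool (bernoulli_pmf (q (exit_node i xs)))"
      unfolding edge_lengths_def using fin by (simp add: Pi_pmf_component all_nodes_def)
    then show "map_spmf (terminal_trajectory i xs)
        (spmf_of_pmf (map_pmf (\<lambda>l. l (exit_node i xs, None)) (edge_lengths inst))) =
      map_spmf (terminal_trajectory i xs) (spmf_of_pmf (map_pmf of_bool (bernoulli_pmf (q (exit_node i xs)))))"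
      by simp
  qed
  finally show ?thesis
    by (simp add: map_pmf_comp)
qed

lemma set_epoch_law_terminal:
  assumes "i < K" "P \<in> set_spmf (epoch_law inst i)"
  shows "fst P = i" "last_node P < K" "reward P \<in> {0, 1}"
proof -
  obtain xs b where "xs \<in> set_spmf (walk i)" "P = terminal_trajectory i xs (of_bool b)"
    using assms(2) by (auto simp: epoch_law_terminal[OF assms(1)] set_bind_spmf bind_UNION)
  with terminal_trajectory_simps[OF set_walk] exit_node_less[OF set_walk assms(1)]
  show "fst P = i" "last_node P < K" "reward P \<in> {0, 1}"
    by auto
qed

lemma lossless_epoch_law_terminal: "i < K \<Longrightarrow> lossless_spmf (epoch_law inst i)"
  by (simp add: epoch_law_terminal lossless_walk)

lemma expect_epoch_law_terminal:
  assumes q: "\<And>i. 0 \<le> q i" "\<And>i. q i \<le> 1" and i: "i < K"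
    and g: "\<And>P. P \<in> set_spmf (epoch_law inst i) \<Longrightarrow> \<bar>g P\<bar> \<le> B"
  shows "expect (epoch_law inst i) g = expect (walk i) (\<lambda>xs.
    q (exit_node i xs) * g (terminal_trajectory i xs 1) +
    (1 - q (exit_node i xs)) * g (terminal_trajectory i xs 0))"
  using g unfolding epoch_law_terminal[OF i]
  by (subst expect_bind[where B = B]) (auto simp: expect_map q algebra_simps simp del: map_spmf_of_pmf)

lemma expect_exit_reward:
  assumes q: "\<And>i. 0 \<le> q i" "\<And>i. q i \<le> 1" and i: "i < K"
    and g: "\<And>P. P \<in> set_spmf (epoch_law inst i) \<Longrightarrow> g P = \<gamma> (last_node P) (reward P)"
  shows "expect (epoch_law inst i) g = h * (q i * \<gamma> i 1 + (1 - q i) * \<gamma> i 0) +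
    (1 - h) / K * (\<Sum>j<K. q j * \<gamma> j 1 + (1 - q j) * \<gamma> j 0)"
proof -
  \<comment> \<open>On the support only finitely many pairs of exit node and reward occur, so
    \<open>\<gamma>\<close> is bounded there by \<open>C\<close>.\<close>
  define C where "C = (\<Sum>j<K. \<bar>\<gamma> j 0\<bar> + \<bar>\<gamma> j 1\<bar>)"
  have C: "\<bar>\<gamma> j x\<bar> \<le> C" if "j < K" "x \<in> {0, 1}" for j x
  proof -
    have "\<bar>\<gamma> j 0\<bar> + \<bar>\<gamma> j 1\<bar> \<le> C"
      unfolding C_def using that by (intro member_le_sum) auto
    then show ?thesis
      using that by auto
  qed
  have "expect (epoch_law inst i) g = expect (epoch_law inst i) (\<lambda>P. \<gamma> (last_node P) (reward P))"
    by (rule expect_cong[OF g])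
  also have "\<dots> = expect (walk i) (\<lambda>xs.
    q (exit_node i xs) * \<gamma> (exit_node i xs) 1 + (1 - q (exit_node i xs)) * \<gamma> (exit_node i xs) 0)"
    by (subst expect_epoch_law_terminal[OF q i, where B = C])
       (auto intro!: expect_cong C simp: terminal_trajectory_simps[OF set_walk]
          dest: set_epoch_law_terminal(2,3)[OF i])
  also have "\<dots> = h * (q i * \<gamma> i 1 + (1 - q i) * \<gamma> i 0) +
    (1 - h) / K * (\<Sum>j<K. q j * \<gamma> j 1 + (1 - q j) * \<gamma> j 0)"
    by (rule expect_exit_node[OF i, where \<phi> = "\<lambda>j. q j * \<gamma> j 1 + (1 - q j) * \<gamma> j 0"])
  finally show ?thesis .
qed

text \<open>Only the first summand depends on the starting node, so differences of mean rewards are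
  \<open>h\<close> times differences of \<open>q\<close>.\<close>

lemma mean_reward_terminal:
  assumes "\<And>i. 0 \<le> q i" "\<And>i. q i \<le> 1" "i < K"
  shows "mean_reward inst i = h * q i + (1 - h) / K * (\<Sum>j<K. q j)"
  unfolding mean_reward_def
  using expect_exit_reward[OF assms, of reward "\<lambda>_ x. x"] by simp

end

end

section \<open>Change of measure\<close>

text \<open>\<open>R\<close> is the density of the second measure with respect to the first, and \<open>- ln R\<close> integrates to
  the relative entropy.\<close>

lemma pinsker_pointwise:
  fixes R :: real
  assumes "0 < R"
  shows "3 * (R - 1)\<^sup>2 \<le> (4 * R + 2) * (R - 1 - ln R)"
proof -
  \<comment> \<open>With the denominator \<open>4 * R + 2\<close> the derivative becomes a positive
    multiple of \<open>(R - 1) ^ 3\<close> for positive \<open>R\<close>. So \<open>F\<close>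
    decreases up to 1, increases afterwards, and has minimum \<open>F 1 = 0\<close>.\<close>
  define F where "F R = R - 1 - ln R - 3 * (R - 1)\<^sup>2 / (4 * R + 2)" for R :: real
  have deriv: "(F has_real_derivative 4 * (R - 1) ^ 3 / (R * (4 * R + 2)\<^sup>2)) (at R)" if "0 < R" for R
  proof -
    have ne: "4 * R + 2 \<noteq> 0"
      using that by simp
    have "(F has_real_derivative 1 - 1 / R - (6 * (R - 1) * (4 * R + 2) - 3 * (R - 1)\<^sup>2 * 4) / (4 * R + 2)\<^sup>2) (at R)"
      unfolding F_def using that ne
      by (auto intro!: derivative_eq_intros simp: power2_eq_square)
    moreover have "1 - 1 / R - (6 * (R - 1) * (4 * R + 2) - 3 * (R - 1)\<^sup>2 * 4) / (4 * R + 2)\<^sup>2 =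
        4 * (R - 1) ^ 3 / (R * (4 * R + 2)\<^sup>2)"
      using that ne by (simp add: divide_simps) (simp add: algebra_simps power2_eq_square power3_eq_cube)
    ultimately show ?thesis by simp
  qed
  have "0 \<le> F R"
  proof (cases "1 \<le> R")
    case True
    have "F 1 \<le> F R"
    proof (rule DERIV_nonneg_imp_nondecreasing[OF True])
      fix x :: real
      assume "1 \<le> x"
      then show "\<exists>y. (F has_real_derivative y) (at x) \<and> 0 \<le> y"
        by (intro exI[of _ "4 * (x - 1) ^ 3 / (x * (4 * x + 2)\<^sup>2)"] conjI deriv) auto
    qed
    then show ?thesis by (simp add: F_def)
  next
    case False
    then have "R \<le> 1" by simp
    have "F 1 \<le> F R"
    proof (rule DERIV_nonpos_imp_nonincreasing[OF \<open>R \<le> 1\<close>])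
      fix x :: real
      assume x: "R \<le> x" "x \<le> 1"
      have "(x - 1) ^ 3 \<le> 0"
        using x by (simp add: power_le_zero_eq)
      then show "\<exists>y. (F has_real_derivative y) (at x) \<and> y \<le> 0"
        using x assms
        by (intro exI[of _ "4 * (x - 1) ^ 3 / (x * (4 * x + 2)\<^sup>2)"] conjI deriv)
           (auto intro!: divide_nonpos_nonneg)
    qed
    then show ?thesis by (simp add: F_def)
  qed
  then have "3 * (R - 1)\<^sup>2 / (4 * R + 2) \<le> R - 1 - ln R"
    by (simp add: F_def)
  then show ?thesis
    using assms by (simp add: pos_divide_le_eq mult.commute)
qed

text \<open>The left side is at most the positive part of \<open>1 - R\<close>, that is,
  \<open>(\<bar>R - 1\<bar> - (R - 1)) / 2\<close>. Pointwise Pinsker bounds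
  \<open>\<bar>R - 1\<bar>\<close> by the square root of a product, and the arithmetic-geometric
  mean inequality with free weight \<open>\<mu>\<close> makes this linear in \<open>R\<close> and
  \<open>ln R\<close>. The result can be integrated and summed over \<open>k\<close> before
  \<open>\<mu>\<close> is optimised.\<close>

lemma mult_one_minus_le_log:
  fixes R y \<mu> :: real
  assumes R: "0 < R" and y: "0 \<le> y" "y \<le> 1" and \<mu>: "0 < \<mu>"
  shows "y * (1 - R) \<le> \<mu> / 2 + (\<mu> / 3 + 1 / (4 * \<mu>) - 1 / 2) * (R - 1) - ln R / (4 * \<mu>)"
proof -
  define A where "A = (4 * R + 2) / 3"
  define D where "D = R - 1 - ln R"
  have D: "0 \<le> D"
    using ln_le_minus_one[OF R] by (simp add: D_def)
  have A: "0 \<le> A"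
    using R by (simp add: A_def)
  have "\<bar>R - 1\<bar> \<le> sqrt (A * D)"
    using pinsker_pointwise[OF R] by (intro real_le_rsqrt) (simp add: A_def D_def)
  also have "sqrt (A * D) = sqrt ((\<mu> * A) * (D / \<mu>))"
    using \<mu> by simp
  also have "\<dots> \<le> (\<mu> * A + D / \<mu>) / 2"
    using A D \<mu> by (intro arith_geo_mean_sqrt) auto
  finally have *: "\<bar>R - 1\<bar> \<le> (\<mu> * A + D / \<mu>) / 2" .
  have "y * (1 - R) \<le> (\<bar>R - 1\<bar> - (R - 1)) / 2"
  proof (cases "R \<le> 1")
    case True
    then have "y * (1 - R) \<le> 1 * (1 - R)"
      using y by (intro mult_right_mono) auto
    then show ?thesis
      using True by simp
  next
    case False
    then show ?thesis
      using y by (simp add: mult_nonneg_nonpos)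
  qed
  also have "\<dots> \<le> ((\<mu> * A + D / \<mu>) / 2 - (R - 1)) / 2"
    by (intro divide_right_mono diff_right_mono *) simp
  also have "\<dots> = \<mu> / 2 + (\<mu> / 3 + 1 / (4 * \<mu>) - 1 / 2) * (R - 1) - ln R / (4 * \<mu>)"
    using \<mu> by (simp add: A_def D_def field_simps)
  finally show ?thesis .
qed

section \<open>Base and spiked instances, and the weight between them\<close>

definition spike :: "nat \<Rightarrow> real \<Rightarrow> real \<Rightarrow> nat \<Rightarrow> real" where
  "spike k a b i = (if i = k then b else a)"

text \<open>The likelihood ratio of one epoch, spiked over base, when \<open>w1 = b / a\<close> and
  \<open>w0 = (1 - b) / (1 - a)\<close>. Keeping the two values as parameters also covers
  \<open>a = 0\<close>, \<open>b = 1\<close>, where both are set to 0.\<close>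

definition exit_weight :: "nat \<Rightarrow> real \<Rightarrow> real \<Rightarrow> trajectory \<Rightarrow> real" where
  "exit_weight k w1 w0 P = (if last_node P = k then if reward P = 1 then w1 else w0 else 1)"

lemma spike_bounds: "0 \<le> a \<Longrightarrow> 0 \<le> b \<Longrightarrow> 0 \<le> spike k a b i" "a \<le> 1 \<Longrightarrow> b \<le> 1 \<Longrightarrow> spike k a b i \<le> 1"
  by (auto simp: spike_def)

lemma expect_one_minus:
  assumes "lossless_spmf p" "\<And>x. x \<in> set_spmf p \<Longrightarrow> \<bar>f x\<bar> \<le> B"
  shows "expect p (\<lambda>x. 1 - f x) = 1 - expect p f"
  using assms by (subst Bochner_Integration.integral_diff)
    (auto simp: lossless_spmf_def integrable_spmf_bounded[of p f B])

lemma sum_pmf_le_1: "(\<Sum>k<K. pmf p k) \<le> 1" for K :: nat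
  using measure_pmf.prob_le_1[of p "{..<K}"] by (simp add: measure_measure_pmf_finite)

lemma integrable_pmf: "integrable (measure_spmf p) (\<lambda>hist. pmf (f hist) k)"
  by (rule integrable_spmf_bounded[where B = 1]) (simp add: pmf_le_1)

lemma lossless_history_terminal:
  assumes "0 < h" "h < 1" "0 < K" "is_policy K \<pi>"
  shows "lossless_spmf (history_law (terminal_reward_instance h K q) \<pi> t)"
  using assms by (intro lossless_history lossless_epoch_law_terminal)

context
  fixes h :: real and K :: nat and \<pi> :: policy and a b :: real
  assumes h: "0 < h" "h < 1" and K: "0 < K" and pol: "is_policy K \<pi>"
    and a: "0 \<le> a" "a \<le> 1" and b: "0 \<le> b" "b \<le> 1" and ab: "a \<le> b"
begin

abbreviation "base \<equiv> terminal_reward_instance h K (\<lambda>_. a)"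
abbreviation "spiked k \<equiv> terminal_reward_instance h K (spike k a b)"

text \<open>Both instances have the same walk, so the comparison is made path by path. The two
  Bernoulli laws differ only when the walk exits at \<open>k\<close>, and there the hypotheses on
  \<open>w1\<close> and \<open>w0\<close> compare the two outcomes separately.\<close>

lemma exit_weight_change:
  assumes w: "0 \<le> w1" "0 \<le> w0" "a * w1 \<le> b" "(1 - a) * w0 \<le> 1 - b" and j: "j < K"
    and g: "\<And>P. 0 \<le> g P" "\<And>P. g P \<le> B"
  shows "expect (epoch_law base j) (\<lambda>P. exit_weight k w1 w0 P * g P) \<le> expect (epoch_law (spiked k) j) g"
proof -
  let ?C = "(1 + w1 + w0) * B"
  have B: "0 \<le> B"
    using g order_trans by blast
  have wg: "\<bar>exit_weight k w1 w0 P * g P\<bar> \<le> ?C" for P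
  proof -
    have "0 \<le> exit_weight k w1 w0 P" "exit_weight k w1 w0 P \<le> 1 + w1 + w0"
      using w by (auto simp: exit_weight_def)
    then show ?thesis
      using g[of P] by (auto simp: abs_mult intro!: mult_mono)
  qed
  let ?\<tau> = "terminal_trajectory j"
  let ?s = "\<lambda>xs. spike k a b (exit_node j xs)"
  have sp: "0 \<le> spike k a b i" "spike k a b i \<le> 1" for i
    using a b by (auto simp: spike_def)
  have "expect (epoch_law base j) (\<lambda>P. exit_weight k w1 w0 P * g P) =
      expect (walk h K j) (\<lambda>xs. a * (exit_weight k w1 w0 (?\<tau> xs 1) * g (?\<tau> xs 1)) +
        (1 - a) * (exit_weight k w1 w0 (?\<tau> xs 0) * g (?\<tau> xs 0)))"
    by (rule expect_epoch_law_terminal[OF h K a j wg])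
  also have "\<dots> \<le> expect (walk h K j) (\<lambda>xs. ?s xs * g (?\<tau> xs 1) + (1 - ?s xs) * g (?\<tau> xs 0))"
  proof (rule expect_mono)
    fix xs
    assume "xs \<in> set_spmf (walk h K j)"
    note \<tau> = terminal_trajectory_simps[OF set_walk[OF h K this]]
    have "a * w1 * g (?\<tau> xs 1) \<le> b * g (?\<tau> xs 1)" "(1 - a) * w0 * g (?\<tau> xs 0) \<le> (1 - b) * g (?\<tau> xs 0)"
      by (intro mult_right_mono w g)+
    then show "a * (exit_weight k w1 w0 (?\<tau> xs 1) * g (?\<tau> xs 1)) +
        (1 - a) * (exit_weight k w1 w0 (?\<tau> xs 0) * g (?\<tau> xs 0)) \<le> ?s xs * g (?\<tau> xs 1) + (1 - ?s xs) * g (?\<tau> xs 0)"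
      by (simp add: exit_weight_def \<tau> spike_def mult.assoc)
    have convex: "\<bar>s * x + (1 - s) * y\<bar> \<le> D" if "0 \<le> s" "s \<le> 1" "\<bar>x\<bar> \<le> D" "\<bar>y\<bar> \<le> D" for s x y D :: real
    proof -
      have "\<bar>s * x + (1 - s) * y\<bar> \<le> s * \<bar>x\<bar> + (1 - s) * \<bar>y\<bar>"
        using that abs_triangle_ineq[of "s * x" "(1 - s) * y"] by (simp add: abs_mult)
      also have "\<dots> \<le> s * D + (1 - s) * D"
        using that by (intro add_mono mult_left_mono) auto
      finally show ?thesis by (simp add: algebra_simps)
    qed
    show "\<bar>a * (exit_weight k w1 w0 (?\<tau> xs 1) * g (?\<tau> xs 1)) +
        (1 - a) * (exit_weight k w1 w0 (?\<tau> xs 0) * g (?\<tau> xs 0))\<bar> \<le> ?C"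
      by (rule convex[OF a wg wg])
    show "\<bar>?s xs * g (?\<tau> xs 1) + (1 - ?s xs) * g (?\<tau> xs 0)\<bar> \<le> B"
      by (rule convex[OF sp]) (use g in \<open>auto simp: abs_of_nonneg\<close>)
  qed
  also have "\<dots> = expect (epoch_law (spiked k) j) g"
    by (rule expect_epoch_law_terminal[OF h K sp j, symmetric, where B = B])
       (use g in \<open>auto simp: abs_of_nonneg\<close>)
  finally show ?thesis .
qed

context
  fixes w1 w0 :: real
  assumes w: "0 \<le> w1" "0 \<le> w0" "a * w1 \<le> b" "(1 - a) * w0 \<le> 1 - b"
begin

abbreviation "W k hist \<equiv> prod_list (map (exit_weight k w1 w0) hist)"

lemma exit_weight_bounds: "0 \<le> exit_weight k w1 w0 P" "exit_weight k w1 w0 P \<le> 1 + w1 + w0"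
  using w by (auto simp: exit_weight_def)

lemma abs_W_le: "hist \<in> set_spmf (history_law I \<pi> t) \<Longrightarrow> \<bar>W k hist\<bar> \<le> (1 + w1 + w0) ^ t"
  using prod_list_bounds[of "exit_weight k w1 w0" "1 + w1 + w0" hist, OF exit_weight_bounds] length_history
  by (metis abs_of_nonneg)

lemma history_weight_change:
  assumes "\<And>hist. 0 \<le> g hist" "\<And>hist. g hist \<le> B"
  shows "expect (history_law base \<pi> t) (\<lambda>hist. W k hist * g hist) \<le> expect (history_law (spiked k) \<pi> t) g"
  by (rule history_change_of_measure[OF pol exit_weight_bounds _ assms])
     (rule exit_weight_change[OF w])

text \<open>Change of measure bounds expectations under the spiked instance from below only. It is
  applied to \<open>1 - f\<close>, and total mass 1 turns the result into an upper bound for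
  \<open>f\<close>.\<close>

lemma expect_choice_le:
  assumes f: "\<And>hist. 0 \<le> f hist" "\<And>hist. f hist \<le> 1"
  shows "expect (history_law (spiked k) \<pi> t) f \<le>
    expect (history_law base \<pi> t) (\<lambda>hist. f hist + (1 - f hist) * (1 - W k hist))"
proof -
  let ?E = "\<lambda>I. expect (history_law I \<pi> t)"
  have "?E base (\<lambda>hist. W k hist * (1 - f hist)) \<le> ?E (spiked k) (\<lambda>hist. 1 - f hist)"
    by (rule history_weight_change[where B = 1]) (use f in auto)
  also have "\<dots> = 1 - ?E (spiked k) f"
    by (rule expect_one_minus[OF lossless_history_terminal[OF h K pol], where B = 1]) (use f in auto)
  finally have "?E (spiked k) f \<le> 1 - ?E base (\<lambda>hist. W k hist * (1 - f hist))"
    by simp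
  also have "\<dots> = ?E base (\<lambda>hist. 1 - W k hist * (1 - f hist))"
  proof (rule expect_one_minus[OF lossless_history_terminal[OF h K pol], where B = "(1 + w1 + w0) ^ t", symmetric])
    fix hist
    assume "hist \<in> set_spmf (history_law base \<pi> t)"
    then have "\<bar>W k hist\<bar> * \<bar>1 - f hist\<bar> \<le> (1 + w1 + w0) ^ t * 1"
      using f[of hist] w by (intro mult_mono abs_W_le) auto
    then show "\<bar>W k hist * (1 - f hist)\<bar> \<le> (1 + w1 + w0) ^ t"
      by (simp add: abs_mult)
  qed
  also have "\<dots> = ?E base (\<lambda>hist. f hist + (1 - f hist) * (1 - W k hist))"
    by (simp add: algebra_simps)
  finally show ?thesis .
qed

lemma expect_W_le: "expect (history_law base \<pi> t) (W k) \<le> 1"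
  using history_weight_change[of "\<lambda>_. 1" 1 t k] lossless_history_terminal[OF h K pol, of "spike k a b" t]
  by (simp add: lossless_spmf_def)

end

text \<open>Node \<open>k\<close> is optimal because \<open>a \<le> b\<close>, and each epoch
  started elsewhere costs exactly \<open>h * (b - a)\<close>. Hence the regret is an additive score
  of the history.\<close>

lemma expected_regret_spiked:
  assumes k: "k < K"
  shows "expected_regret (spiked k) \<pi> T =
    h * (b - a) * (\<Sum>t<T. 1 - expect (history_law (spiked k) \<pi> t) (\<lambda>hist. pmf (\<pi> hist) k))"
proof -
  define c where "c = (1 - h) / K * (\<Sum>j<K. spike k a b j)"
  define s where "s P = h * (b - a) * of_bool (fst P \<noteq> k)" for P :: trajectory
  have mean: "mean_reward (spiked k) i = h * spike k a b i + c" if "i < K" for i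
    unfolding c_def using a b by (intro mean_reward_terminal[OF h K _ _ that] spike_bounds)
  have max: "(MAX i\<in>{..<K}. \<Sum>t<T. mean_reward (spiked k) i) = (\<Sum>t<T. mean_reward (spiked k) k)"
  proof (rule Max_eqI)
    fix y
    assume "y \<in> (\<lambda>i. \<Sum>t<T. mean_reward (spiked k) i) ` {..<K}"
    then obtain i where i: "i < K" "y = (\<Sum>t<T. mean_reward (spiked k) i)"
      by auto
    show "y \<le> (\<Sum>t<T. mean_reward (spiked k) k)"
      unfolding i(2) using i(1) k h ab by (intro sum_mono) (auto simp: mean spike_def)
  qed (use k in auto)
  have regret: "regret (spiked k) T hist = sum_list (map s hist)"
    if hist: "hist \<in> set_spmf (history_law (spiked k) \<pi> T)" for hist
  proof -
    have len: "length hist = T"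
      by (rule length_history[OF hist])
    have fst: "fst P < K" if "P \<in> set hist" for P
      using set_history[OF pol _ hist that, of "\<lambda>P. fst P < K"] set_epoch_law_terminal(1)[OF h K]
      by metis
    have "regret (spiked k) T hist = (\<Sum>t<T. mean_reward (spiked k) k - mean_reward (spiked k) (fst (hist ! t)))"
      unfolding regret_def terminal_reward_instance_sel max by (rule sum_subtractf[symmetric])
    also have "\<dots> = (\<Sum>t<T. s (hist ! t))"
    proof (rule sum.cong[OF refl])
      fix t
      assume "t \<in> {..<T}"
      then have "fst (hist ! t) < K"
        using fst len by simp
      then show "mean_reward (spiked k) k - mean_reward (spiked k) (fst (hist ! t)) = s (hist ! t)"
        using k by (simp add: mean s_def spike_def algebra_simps)
    qed
    also have "\<dots> = sum_list (map s hist)"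
      using len by (simp add: sum_list_sum_nth atLeast0LessThan)
    finally show ?thesis .
  qed
  have s_le: "\<bar>s P\<bar> \<le> h * (b - a)" for P
    using h ab by (simp add: s_def)
  have epoch: "expect (epoch_law (spiked k) j) s = h * (b - a) * of_bool (j \<noteq> k)" if "j < K" for j
  proof -
    have "expect (epoch_law (spiked k) j) s = expect (epoch_law (spiked k) j) (\<lambda>_. h * (b - a) * of_bool (j \<noteq> k))"
      by (rule expect_cong) (simp add: s_def set_epoch_law_terminal(1)[OF h K that])
    then show ?thesis
      using lossless_epoch_law_terminal[OF h K that, of "spike k a b"] by (simp add: lossless_spmf_def)
  qed
  have choice: "(\<integral>j. expect (epoch_law (spiked k) j) s \<partial>measure_pmf (\<pi> hist)) = h * (b - a) * (1 - pmf (\<pi> hist) k)" for hist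
  proof -
    have "(\<integral>j. expect (epoch_law (spiked k) j) s \<partial>measure_pmf (\<pi> hist)) =
        (\<integral>j. h * (b - a) * indicator (- {k}) j \<partial>measure_pmf (\<pi> hist))"
      by (rule integral_pmf_cong) (auto simp: epoch is_policyD[OF pol] indicator_def)
    also have "\<dots> = h * (b - a) * measure (measure_pmf (\<pi> hist)) (- {k})"
      by simp
    also have "measure (measure_pmf (\<pi> hist)) (- {k}) = 1 - pmf (\<pi> hist) k"
      using measure_pmf.prob_compl[of "{k}" "\<pi> hist"] by (simp add: measure_pmf_single Compl_eq_Diff_UNIV)
    finally show ?thesis .
  qed
  have "expected_regret (spiked k) \<pi> T = expect (history_law (spiked k) \<pi> T) (\<lambda>hist. sum_list (map s hist))"
    unfolding expected_regret_def by (rule expect_cong) (rule regret)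
  also have "\<dots> = (\<Sum>t<T. expect (history_law (spiked k) \<pi> t) (\<lambda>hist. h * (b - a) * (1 - pmf (\<pi> hist) k)))"
    by (subst expect_history_sum_list[OF pol lossless_epoch_law_terminal[OF h K] s_le]) (simp_all add: choice)
  also have "\<dots> = (\<Sum>t<T. h * (b - a) * (1 - expect (history_law (spiked k) \<pi> t) (\<lambda>hist. pmf (\<pi> hist) k)))"
    by (simp add: expect_one_minus[OF lossless_history_terminal[OF h K pol], where B = 1] pmf_le_1)
  finally show ?thesis
    by (simp add: sum_distrib_left)
qed

text \<open>The maximum over the instances is at least their average, so it suffices to bound the
  probabilities of playing the good node summed over \<open>k\<close>.\<close>

lemma max_regret_ge:
  fixes c :: "nat \<Rightarrow> real"
  assumes "\<And>t. t < T \<Longrightarrow> (\<Sum>k<K. expect (history_law (spiked k) \<pi> t) (\<lambda>hist. pmf (\<pi> hist) k)) \<le> c t"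
  shows "h * (b - a) / K * (\<Sum>t<T. K - c t) \<le> (MAX k\<in>{..<K}. expected_regret (spiked k) \<pi> T)"
proof -
  let ?p = "\<lambda>k t. expect (history_law (spiked k) \<pi> t) (\<lambda>hist. pmf (\<pi> hist) k)"
  let ?M = "MAX k\<in>{..<K}. expected_regret (spiked k) \<pi> T"
  have "h * (b - a) * (\<Sum>t<T. K - c t) \<le> h * (b - a) * (\<Sum>t<T. K - (\<Sum>k<K. ?p k t))"
    using assms h ab by (intro mult_left_mono sum_mono diff_left_mono) auto
  also have "(\<Sum>t<T. K - (\<Sum>k<K. ?p k t)) = (\<Sum>t<T. \<Sum>k<K. 1 - ?p k t)"
    by (simp add: sum_subtractf)
  also have "\<dots> = (\<Sum>k<K. \<Sum>t<T. 1 - ?p k t)"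
    by (rule sum.swap)
  also have "h * (b - a) * \<dots> = (\<Sum>k<K. expected_regret (spiked k) \<pi> T)"
    by (simp add: expected_regret_spiked sum_distrib_left)
  also have "\<dots> \<le> (\<Sum>k<K. ?M)"
    by (intro sum_mono Max_ge) auto
  finally show ?thesis
    using K by (simp add: field_simps)
qed

end

section \<open>Expected number of plays of the good node\<close>

context
  fixes h :: real and K :: nat and \<pi> :: policy and a b :: real
  assumes h: "0 < h" "h < 1" and K: "0 < K" and pol: "is_policy K \<pi>"
    and a: "0 < a" "a < 1" and b: "0 < b" "b < 1" and ab: "a \<le> b"
begin

abbreviation "E0 \<equiv> \<lambda>t. expect (history_law (terminal_reward_instance h K (\<lambda>_. a)) \<pi> t)"
abbreviation "lw k \<equiv> exit_weight k (b / a) ((1 - b) / (1 - a))"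
abbreviation "kl \<equiv> a * ln (a / b) + (1 - a) * ln ((1 - a) / (1 - b))"

text \<open>A trajectory has one exit node, and every other \<open>k\<close> has weight 1 and
  logarithm 0. This collapse is why the relative entropies of all \<open>K\<close> instances
  together cost no more than one Bernoulli sample per epoch.\<close>

lemma sum_log_weight:
  assumes "last_node P < K"
  shows "(\<Sum>k<K. - ln (lw k P)) = (if reward P = 1 then ln (a / b) else ln ((1 - a) / (1 - b)))"
proof -
  have "(\<Sum>k<K. - ln (lw k P)) =
    (\<Sum>k<K. if k = last_node P then if reward P = 1 then ln (a / b) else ln ((1 - a) / (1 - b)) else 0)"
    using a b by (intro sum.cong) (auto simp: exit_weight_def ln_div)
  then show ?thesis
    using assms by simp
qed

lemma lw_pos: "0 < lw k P"
  using a b by (auto simp: exit_weight_def)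

lemma ln_prod_lw: "0 < prod_list (map (lw k) hist) \<and>
    ln (prod_list (map (lw k) hist)) = sum_list (map (\<lambda>P. ln (lw k P)) hist)"
  by (induction hist) (use lw_pos in \<open>auto simp: ln_mult_pos\<close>)

lemma abs_ln_prod_lw_le:
  obtains C where "0 \<le> C" "\<And>k t hist. hist \<in> set_spmf (history_law I \<pi> t) \<Longrightarrow> \<bar>ln (prod_list (map (lw k) hist))\<bar> \<le> real t * C"
proof
  let ?C = "\<bar>ln (b / a)\<bar> + \<bar>ln ((1 - b) / (1 - a))\<bar>"
  show "0 \<le> ?C" by simp
  fix k t hist
  assume "hist \<in> set_spmf (history_law I \<pi> t)"
  then show "\<bar>ln (prod_list (map (lw k) hist))\<bar> \<le> real t * ?C"
    using abs_sum_list_map_le[of "\<lambda>P. ln (lw k P)" ?C hist]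
    by (auto simp: ln_prod_lw length_history exit_weight_def)
qed

text \<open>Under the base instance every epoch yields one Bernoulli sample with parameter
  \<open>a\<close>, wherever it starts. It therefore contributes \<open>kl\<close> whatever the
  policy does.\<close>

lemma expect_sum_log_weight:
  "E0 t (\<lambda>hist. \<Sum>k<K. - ln (prod_list (map (lw k) hist))) = real t * kl"
proof -
  define s where "s P = (if reward P = 1 then ln (a / b) else ln ((1 - a) / (1 - b)))" for P :: trajectory
  have "E0 t (\<lambda>hist. \<Sum>k<K. - ln (prod_list (map (lw k) hist))) = E0 t (\<lambda>hist. sum_list (map s hist))"
  proof (rule expect_cong)
    fix hist
    assume hist: "hist \<in> set_spmf (history_law (terminal_reward_instance h K (\<lambda>_. a)) \<pi> t)"
    have last: "last_node P < K" if "P \<in> set hist" for P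
      using set_history[OF pol _ hist that, of "\<lambda>P. last_node P < K"] set_epoch_law_terminal(2)[OF h K]
      by metis
    have "(\<Sum>k<K. - ln (prod_list (map (lw k) hist))) = (\<Sum>k<K. sum_list (map (\<lambda>P. - ln (lw k P)) hist))"
      by (simp add: ln_prod_lw uminus_sum_list_map o_def)
    also have "\<dots> = (\<Sum>P\<leftarrow>hist. \<Sum>k<K. - ln (lw k P))"
    proof (induction hist)
      case (Cons P hist)
      then show ?case
        by (simp only: list.map sum_list.Cons sum.distrib)
    qed simp
    also have "\<dots> = (\<Sum>P\<leftarrow>hist. s P)"
      by (intro arg_cong[where f = sum_list] map_cong refl) (simp only: s_def sum_log_weight[OF last])
    finally show "(\<Sum>k<K. - ln (prod_list (map (lw k) hist))) = sum_list (map s hist)" .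
  qed
  also have "\<dots> = (\<Sum>u<t. E0 u (\<lambda>hist. \<integral>j. expect (epoch_law (terminal_reward_instance h K (\<lambda>_. a)) j) s \<partial>measure_pmf (\<pi> hist)))"
    by (rule expect_history_sum_list[OF pol lossless_epoch_law_terminal[OF h K],
        where B = "\<bar>ln (a / b)\<bar> + \<bar>ln ((1 - a) / (1 - b))\<bar>"]) (auto simp: s_def)
  also have "\<dots> = (\<Sum>u<t. E0 u (\<lambda>hist. \<integral>j. kl \<partial>measure_pmf (\<pi> hist)))"
  proof (intro sum.cong refl expect_cong integral_pmf_cong)
    fix hist j
    assume "j \<in> set_pmf (\<pi> hist)"
    then have j: "j < K"
      by (rule is_policyD[OF pol])
    have "expect (epoch_law (terminal_reward_instance h K (\<lambda>_. a)) j) s = h * kl + (1 - h) / K * (\<Sum>j<K. kl)"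
      using a by (subst expect_exit_reward[OF h K _ _ j, where
            \<gamma> = "\<lambda>_ x. if x = 1 then ln (a / b) else ln ((1 - a) / (1 - b))"])
        (auto simp: s_def)
    also have "\<dots> = kl"
    proof -
      have "h * x + (1 - h) / K * (\<Sum>j<K. x) = x" for x :: real
        using K by (simp add: field_simps)
      then show ?thesis .
    qed
    finally show "expect (epoch_law (terminal_reward_instance h K (\<lambda>_. a)) j) s = kl" .
  qed
  also have "\<dots> = real t * kl"
    using lossless_history_terminal[OF h K pol] by (simp add: lossless_spmf_def)
  finally show ?thesis .
qed

text \<open>In \<open>expect_choice_le\<close>, the product is bounded by
  \<open>mult_one_minus_le_log\<close> with \<open>R\<close> the weight of the history and
  \<open>y\<close> the probability of not playing \<open>k\<close>. After summation the choice
  probabilities give at most 1 and the logarithms give \<open>t * kl\<close>.\<close>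

lemma sum_choice_le_kl:
  fixes \<mu> :: real
  assumes \<mu>: "0 < \<mu>"
  shows "(\<Sum>k<K. expect (history_law (terminal_reward_instance h K (spike k a b)) \<pi> t) (\<lambda>hist. pmf (\<pi> hist) k))
    \<le> 1 + K * \<mu> / 2 + t * kl / (4 * \<mu>)"
proof -
  let ?W = "\<lambda>k hist. prod_list (map (lw k) hist)"
  let ?p = "\<lambda>k hist. pmf (\<pi> hist) k"
  let ?H = "history_law (terminal_reward_instance h K (\<lambda>_. a)) \<pi> t"
  let ?c = "\<mu> / 3 + 1 / (4 * \<mu>) - 1 / 2"
  \<comment> \<open>Completing the square shows that the coefficient of \<open>?W k hist - 1\<close>
    is nonnegative, so \<open>expect_W_le\<close> allows this term to be dropped.\<close>
  have "0 \<le> (\<mu> - 3 / 4)\<^sup>2 / (3 * \<mu>) + 1 / (16 * \<mu>)"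
    using \<mu> by simp
  also have "\<dots> = ?c"
    using \<mu> by (simp add: field_simps power2_eq_square)
  finally have c: "0 \<le> ?c" .
  have w: "0 \<le> b / a" "0 \<le> (1 - b) / (1 - a)" "a * (b / a) \<le> b" "(1 - a) * ((1 - b) / (1 - a)) \<le> 1 - b"
    using a b by auto
  have ab': "0 \<le> a" "a \<le> 1" "0 \<le> b" "b \<le> 1"
    using a b by auto
  obtain C where C: "0 \<le> C"
    "\<And>k hist. hist \<in> set_spmf ?H \<Longrightarrow> \<bar>ln (?W k hist)\<bar> \<le> real t * C"
    using abs_ln_prod_lw_le[of "terminal_reward_instance h K (\<lambda>_. a)"] by metis
  have [simp]: "integrable (measure_spmf ?H) (?W k)" for k
    by (rule integrable_spmf_bounded) (rule abs_W_le[OF h K pol ab' ab w])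
  have [simp]: "integrable (measure_spmf ?H) (\<lambda>hist. ln (?W k hist))" for k
    by (rule integrable_spmf_bounded) (rule C(2))
  have [simp]: "integrable (measure_spmf ?H) (?p k)" for k
    by (rule integrable_pmf)
  have [simp]: "weight_spmf ?H = 1"
    using lossless_history_terminal[OF h K pol] by (simp add: lossless_spmf_def)
  have "(\<Sum>k<K. expect (history_law (terminal_reward_instance h K (spike k a b)) \<pi> t) (?p k))
    \<le> (\<Sum>k<K. expect ?H (\<lambda>hist. ?p k hist + \<mu> / 2 + ?c * (?W k hist - 1) - ln (?W k hist) / (4 * \<mu>)))"
  proof (rule sum_mono)
    fix k
    have "expect (history_law (terminal_reward_instance h K (spike k a b)) \<pi> t) (?p k)
      \<le> expect ?H (\<lambda>hist. ?p k hist + (1 - ?p k hist) * (1 - ?W k hist))"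
      by (rule expect_choice_le[OF h K pol ab' ab w]) (simp_all add: pmf_le_1)
    also have "\<dots> \<le> expect ?H (\<lambda>hist. ?p k hist + \<mu> / 2 + ?c * (?W k hist - 1) - ln (?W k hist) / (4 * \<mu>))"
    proof (rule integral_mono_AE)
      have "integrable (measure_spmf ?H) (\<lambda>hist. ?p k hist * ?W k hist)"
      proof (rule integrable_spmf_bounded[where B = "1 * (1 + b / a + (1 - b) / (1 - a)) ^ t"])
        fix hist
        assume "hist \<in> set_spmf ?H"
        then show "\<bar>?p k hist * ?W k hist\<bar> \<le> 1 * (1 + b / a + (1 - b) / (1 - a)) ^ t"
          unfolding abs_mult by (intro mult_mono abs_W_le[OF h K pol ab' ab w]) (auto simp: pmf_le_1)
      qed
      then have "integrable (measure_spmf ?H) (\<lambda>hist. 1 - ?W k hist + ?p k hist * ?W k hist)"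
        by (intro Bochner_Integration.integrable_add Bochner_Integration.integrable_diff) auto
      then show "integrable (measure_spmf ?H) (\<lambda>hist. ?p k hist + (1 - ?p k hist) * (1 - ?W k hist))"
        by (simp add: algebra_simps)
      show "integrable (measure_spmf ?H) (\<lambda>hist. ?p k hist + \<mu> / 2 + ?c * (?W k hist - 1) - ln (?W k hist) / (4 * \<mu>))"
        by (intro Bochner_Integration.integrable_add Bochner_Integration.integrable_diff
            integrable_mult_right integrable_divide_zero) auto
      have "(1 - ?p k hist) * (1 - ?W k hist) \<le> \<mu> / 2 + ?c * (?W k hist - 1) - ln (?W k hist) / (4 * \<mu>)" for hist
        by (rule mult_one_minus_le_log) (use ln_prod_lw \<mu> in \<open>auto simp: pmf_le_1\<close>)
      then show "AE hist in measure_spmf ?H. ?p k hist + (1 - ?p k hist) * (1 - ?W k hist) \<le>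
          ?p k hist + \<mu> / 2 + ?c * (?W k hist - 1) - ln (?W k hist) / (4 * \<mu>)"
        by (simp add: algebra_simps)
    qed
    finally show "expect (history_law (terminal_reward_instance h K (spike k a b)) \<pi> t) (?p k) \<le>
      expect ?H (\<lambda>hist. ?p k hist + \<mu> / 2 + ?c * (?W k hist - 1) - ln (?W k hist) / (4 * \<mu>))" .
  qed
  also have "\<dots> = (\<Sum>k<K. expect ?H (?p k) + \<mu> / 2 + ?c * (expect ?H (?W k) - 1) - expect ?H (\<lambda>hist. ln (?W k hist)) / (4 * \<mu>))"
    by simp
  also have "\<dots> \<le> (\<Sum>k<K. expect ?H (?p k) + \<mu> / 2 - expect ?H (\<lambda>hist. ln (?W k hist)) / (4 * \<mu>))"
  proof (rule sum_mono)
    fix k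
    have "?c * (expect ?H (?W k) - 1) \<le> 0"
      using expect_W_le[OF h K pol ab' ab w, of t k] c by (intro mult_nonneg_nonpos) auto
    then show "expect ?H (?p k) + \<mu> / 2 + ?c * (expect ?H (?W k) - 1) - expect ?H (\<lambda>hist. ln (?W k hist)) / (4 * \<mu>)
      \<le> expect ?H (?p k) + \<mu> / 2 - expect ?H (\<lambda>hist. ln (?W k hist)) / (4 * \<mu>)"
      by linarith
  qed
  also have "\<dots> = expect ?H (\<lambda>hist. \<Sum>k<K. ?p k hist) + K * \<mu> / 2 + expect ?H (\<lambda>hist. \<Sum>k<K. - ln (?W k hist)) / (4 * \<mu>)"
    by (simp add: sum.distrib sum_subtractf sum_negf flip: sum_divide_distrib)
  also have "expect ?H (\<lambda>hist. \<Sum>k<K. - ln (?W k hist)) = real t * kl"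
    by (rule expect_sum_log_weight)
  also have "expect ?H (\<lambda>hist. \<Sum>k<K. ?p k hist) \<le> 1"
    using expect_abs_le[of ?H "\<lambda>hist. \<Sum>k<K. ?p k hist" 1] sum_pmf_le_1[where K = K]
    by (auto simp: sum_nonneg)
  finally show ?thesis
    by simp
qed

end

text \<open>The optimal choice is \<open>\<mu> = sqrt (v / 2)\<close>. For \<open>v = 0\<close> this
  is not positive, and the bound is obtained by letting \<open>\<mu>\<close> tend to 0.\<close>

lemma le_sqrt_of_forall_pos:
  fixes x v c :: real
  assumes "0 \<le> v" "0 < K" "\<And>\<mu>. 0 < \<mu> \<Longrightarrow> x \<le> c + K * \<mu> / 2 + K * v / (4 * \<mu>)"
  shows "x \<le> c + K * sqrt (v / 2)"
proof (cases "v = 0")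
  case True
  have "x \<le> c + e" if "0 < e" for e
    using assms(3)[of "2 * e / K"] that assms(2) True by simp
  then show ?thesis
    using True by (simp add: field_le_epsilon)
next
  case False
  define s where "s = sqrt (v / 2)"
  have "s * s = v / 2"
    using assms(1) by (simp add: s_def)
  then have s: "v = 2 * s * s" "0 < s"
    using False assms(1) by (simp, simp add: s_def)
  have "K * v / (4 * s) = K * s / 2"
    using s by (simp add: field_simps)
  then show ?thesis
    using assms(3)[OF s(2)] s(2) by (simp flip: s_def)
qed

text \<open>With zero weights, \<open>?W k hist\<close> is the indicator that no epoch of
  \<open>hist\<close> exits at \<open>k\<close>. Summing \<open>1 - ?W k hist\<close> over
  \<open>k\<close> counts the nodes already sampled, at most one per epoch.\<close>

lemma sum_choice_sparse:
  fixes h :: real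
  assumes h: "0 < h" "h < 1" and K: "0 < K" and pol: "is_policy K \<pi>"
  shows "(\<Sum>k<K. expect (history_law (terminal_reward_instance h K (spike k 0 1)) \<pi> t) (\<lambda>hist. pmf (\<pi> hist) k)) \<le> 1 + real t"
proof -
  let ?w = "\<lambda>k. exit_weight k 0 0"
  let ?W = "\<lambda>k hist. prod_list (map (?w k) hist)"
  let ?p = "\<lambda>k hist. pmf (\<pi> hist) k"
  let ?H = "history_law (terminal_reward_instance h K (\<lambda>_. 0)) \<pi> t"
  have w: "0 \<le> (0::real)" "(0::real) \<le> 0" "0 * 0 \<le> (1::real)" "(1 - 0) * 0 \<le> (1::real) - 1"
    by auto
  have ab: "0 \<le> (0::real)" "0 \<le> (1::real)" "0 \<le> (1::real)" "1 \<le> (1::real)"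
    by auto
  have w01: "0 \<le> ?w k P" "?w k P \<le> 1" for k P
    by (auto simp: exit_weight_def)
  have W: "0 \<le> ?W k hist" "?W k hist \<le> 1" for k hist
    using prod_list_bounds[of "?w k" 1 hist, OF w01] by auto
  have W_sum: "(\<Sum>k<K. 1 - ?W k hist) \<le> length hist" for hist
  proof (induction hist)
    case (Cons P hist)
    have "(\<Sum>k<K. 1 - ?W k (P # hist)) \<le> (\<Sum>k<K. (1 - ?w k P) + (1 - ?W k hist))"
    proof (rule sum_mono)
      fix k
      have "0 \<le> (1 - ?w k P) * (1 - ?W k hist)"
        using w01[of k P] W(2)[of k hist] by (intro mult_nonneg_nonneg) auto
      then show "1 - ?W k (P # hist) \<le> (1 - ?w k P) + (1 - ?W k hist)"
        by (simp add: algebra_simps)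
    qed
    also have "\<dots> = (\<Sum>k<K. 1 - ?w k P) + (\<Sum>k<K. 1 - ?W k hist)"
      by (rule sum.distrib)
    also have "(\<Sum>k<K. 1 - ?w k P) = (\<Sum>k<K. if k = last_node P then 1 else 0)"
      by (intro sum.cong) (auto simp: exit_weight_def)
    also have "\<dots> + (\<Sum>k<K. 1 - ?W k hist) \<le> 1 + real (length hist)"
      by (intro add_mono Cons.IH) simp
    finally show ?case
      by simp
  qed simp
  have bnd: "0 \<le> (1 - ?p k hist) * (1 - ?W k hist)" "(1 - ?p k hist) * (1 - ?W k hist) \<le> 1 - ?W k hist" for k hist
    using W[of k hist] by (auto simp: pmf_le_1 mult_left_le_one_le)
  have "(\<Sum>k<K. expect (history_law (terminal_reward_instance h K (spike k 0 1)) \<pi> t) (?p k)) \<le>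
    (\<Sum>k<K. expect ?H (\<lambda>hist. ?p k hist + (1 - ?p k hist) * (1 - ?W k hist)))"
    by (intro sum_mono expect_choice_le[OF h K pol ab zero_le_one w]) (simp_all add: pmf_le_1)
  also have "\<dots> = expect ?H (\<lambda>hist. \<Sum>k<K. ?p k hist + (1 - ?p k hist) * (1 - ?W k hist))"
  proof (rule Bochner_Integration.integral_sum[symmetric])
    fix k
    show "integrable (measure_spmf ?H) (\<lambda>hist. ?p k hist + (1 - ?p k hist) * (1 - ?W k hist))"
    proof (rule integrable_spmf_bounded[where B = 2])
      fix hist
      show "\<bar>?p k hist + (1 - ?p k hist) * (1 - ?W k hist)\<bar> \<le> 2"
        using bnd[where k = k and hist = hist] W[where k = k and hist = hist]
          pmf_nonneg[of "\<pi> hist" k] pmf_le_1[of "\<pi> hist" k] by linarith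
    qed
  qed
  also have "\<dots> \<le> 1 + real t"
  proof (rule abs_le_D1, rule expect_abs_le)
    fix hist
    assume "hist \<in> set_spmf ?H"
    then have len: "length hist = t"
      by (rule length_history)
    have "(\<Sum>k<K. ?p k hist + (1 - ?p k hist) * (1 - ?W k hist)) \<le> (\<Sum>k<K. ?p k hist) + (\<Sum>k<K. 1 - ?W k hist)"
      unfolding sum.distrib by (intro add_left_mono sum_mono bnd)
    also have "\<dots> \<le> 1 + real t"
      using W_sum[of hist] sum_pmf_le_1[of "\<pi> hist" K] len by simp
    moreover have "0 \<le> (\<Sum>k<K. ?p k hist + (1 - ?p k hist) * (1 - ?W k hist))"
      by (intro sum_nonneg add_nonneg_nonneg bnd) simp
    ultimately show "\<bar>\<Sum>k<K. ?p k hist + (1 - ?p k hist) * (1 - ?W k hist)\<bar> \<le> 1 + real t"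
      by simp
  qed simp
  finally show ?thesis by simp
qed

section \<open>Choice of constants\<close>

lemma ln_ratio_le:
  fixes \<epsilon> :: real
  assumes "0 \<le> \<epsilon>" "\<epsilon> \<le> 3 / 8"
  shows "ln ((1 + \<epsilon>) / (1 - \<epsilon>)) \<le> 2 * (1.04)\<^sup>2 * \<epsilon>"
proof -
  \<comment> \<open>The series of the logarithm starts with \<open>2 * x + 2 / 3 * x ^ 3\<close>;
    raising \<open>2 / 3\<close> to \<open>39 / 50\<close> absorbs the tail for
    \<open>x \<le> 3 / 8\<close>. The final slope is written with the square of 1.04 so that a later
    square root is rational.\<close>
  define G where "G x = 2 * x + 39 / 50 * x ^ 3 - ln (1 + x) + ln (1 - x)" for x :: real
  have "G 0 \<le> G \<epsilon>"
  proof (rule DERIV_nonneg_imp_nondecreasing[OF assms(1)])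
    fix x :: real
    assume x: "0 \<le> x" "x \<le> \<epsilon>"
    then have x': "x \<le> 3 / 8"
      using assms by simp
    have "x\<^sup>2 \<le> (3 / 8)\<^sup>2"
      using x x' by (intro power_mono) auto
    then have "0 \<le> 117 / 50 * (1 - x\<^sup>2) - 2"
      by (simp add: power_divide)
    have "(G has_real_derivative 2 + 117 / 50 * x\<^sup>2 - 1 / (1 + x) - 1 / (1 - x)) (at x)"
      unfolding G_def using x x' by (auto intro!: derivative_eq_intros simp: power2_eq_square)
    moreover have "2 + 117 / 50 * x\<^sup>2 - 1 / (1 + x) - 1 / (1 - x) = x\<^sup>2 * (117 / 50 * (1 - x\<^sup>2) - 2) / ((1 + x) * (1 - x))"
      using x x' by (simp add: divide_simps) (simp add: algebra_simps power2_eq_square)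
    moreover have "0 \<le> \<dots>"
      using x x' \<open>0 \<le> 117 / 50 * (1 - x\<^sup>2) - 2\<close>
      by (intro divide_nonneg_nonneg mult_nonneg_nonneg zero_le_power2) auto
    ultimately show "\<exists>y. (G has_real_derivative y) (at x) \<and> 0 \<le> y"
      by metis
  qed
  then have "ln (1 + \<epsilon>) - ln (1 - \<epsilon>) \<le> 2 * \<epsilon> + 39 / 50 * \<epsilon> ^ 3"
    by (simp add: G_def)
  also have "\<epsilon>\<^sup>2 * \<epsilon> \<le> (3 / 8)\<^sup>2 * \<epsilon>"
    using assms by (intro mult_right_mono power_mono) auto
  then have "2 * \<epsilon> + 39 / 50 * \<epsilon> ^ 3 \<le> 2 * (1.04)\<^sup>2 * \<epsilon>"
    using assms(1) by (simp add: power2_eq_square power3_eq_cube)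
  finally show ?thesis
    using assms by (simp add: ln_div)
qed

lemma sum_sqrt_le: "(\<Sum>t<T. sqrt (real t)) \<le> 2 / 3 * (real T * sqrt (real T))"
proof (induction T)
  case (Suc T)
  define s u where "s = sqrt (real T)" and "u = sqrt (real (Suc T))"
  have su: "0 \<le> s" "s \<le> u"
    by (simp_all add: s_def u_def)
  have T: "real T = s * s" "real (Suc T) = u * u"
    by (simp_all add: s_def u_def)
  then have 1: "u * u - s * s = 1"
    by simp
  \<comment> \<open>Expanded with \<open>u * u - s * s = 1\<close>, this says that \<open>s\<close>
    is at most the increment of \<open>2 / 3 * x ^ 3\<close> from \<open>s\<close> to
    \<open>u\<close>, which is the induction step.\<close>
  have "0 \<le> (u - s) * (u - s) * (2 * u + s)"
    using su by simp
  also have "\<dots> = 2 * (u * u) * u - 2 * (s * s) * s - 3 * s * (u * u - s * s)"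
    by (simp add: algebra_simps)
  finally have "s \<le> 2 / 3 * (real (Suc T) * u) - 2 / 3 * (real T * s)"
    unfolding 1 T by simp
  moreover have "(\<Sum>t<Suc T. sqrt (real t)) = (\<Sum>t<T. sqrt (real t)) + s"
    by (simp add: s_def)
  ultimately show ?case
    using Suc.IH unfolding s_def u_def by linarith
qed simp

lemma sqrt_2_bound: "1 / (8 * sqrt 2) \<le> (0.0884 :: real)"
proof -
  have "1.4141 \<le> sqrt (2 :: real)"
    by (rule real_le_rsqrt) (simp add: power2_eq_square)
  then show ?thesis
    by (simp add: divide_simps)
qed

text \<open>Inserting \<open>1 + t\<close> into \<open>max_regret_ge\<close> and writing
  \<open>s = sqrt (K / T)\<close> reduces the claim to a cubic inequality in \<open>s\<close> on the
  interval from 1 to 10.\<close>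

lemma max_regret_sparse:
  assumes K: "2 \<le> K" "T \<le> K" "K \<le> 100 * T" and pol: "is_policy K \<pi>"
  shows "1 / (8 * sqrt 2) * sqrt (real K * real T) \<le>
    (MAX k\<in>{..<K}. expected_regret (terminal_reward_instance (99 / 100) K (spike k 0 1)) \<pi> T)"
proof -
  define s where "s = sqrt (real K / real T)"
  have T: "0 < T"
    using K by auto
  have sT: "s * s * T = K"
    using T by (simp add: s_def)
  \<comment> \<open>The upper bound is \<open>K \<le> 100 * T\<close>. Since the regret is at most
    \<open>h * T\<close>, the claim could not hold for \<open>s\<close> above
    \<open>8 * sqrt 2 * h\<close>, about 11.2.\<close>
  have s: "1 \<le> s" "s \<le> 10"
    unfolding s_def using T K by (auto intro!: real_le_lsqrt simp: pos_divide_le_eq)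
  have "sqrt (real K * real T) = sqrt ((s * T)\<^sup>2)"
    by (simp only: power2_eq_square mult_ac flip: sT)
  also have "\<dots> = s * T"
    using s by simp
  finally have root: "sqrt (real K * real T) = s * T" .
  have sum: "(\<Sum>t<T. real K - (1 + real t)) = T * (K - (T + 1) / 2)"
    by (induction T) (simp_all add: field_simps)
  have poly: "0.0884 * s * (s * s) + 0.99 / 2 + 0.99 * (s * s) / (2 * K) \<le> 0.99 * (s * s)"
  \<comment> \<open>The term with \<open>2 * K\<close> in the denominator is controlled by
    \<open>2 \<le> K\<close> for small \<open>s\<close>, and by \<open>s * s \<le> K\<close> (from
    \<open>1 \<le> T\<close>) for large \<open>s\<close>.\<close>
  proof (cases "s \<le> 2")
    case True
    have "0.99 * (s * s) / (2 * K) \<le> 0.99 * (s * s) / 4"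
      using K by (intro divide_left_mono) auto
    moreover have "0.0884 * s * (s * s) \<le> 0.0884 * 2 * (s * s)"
      using True by (intro mult_right_mono) auto
    moreover have "1 \<le> s * s"
      using s mult_mono[of 1 s 1 s] by simp
    ultimately show ?thesis
      by simp
  next
    case False
    have "0.99 * (s * s) / (2 * K) \<le> 0.99 / 2"
    proof -
      have "s * s * 1 \<le> s * s * T"
        using T by (intro mult_left_mono) auto
      then have "s * s \<le> K"
        using sT by simp
      then show ?thesis
        using K by (simp add: divide_simps)
    qed
    moreover have "0.99 \<le> (0.99 - 0.0884 * s) * (s * s)"
    proof -
      have "0 \<le> (10 - s) * (s - 2)"
        using s False by simp
      moreover have "0 \<le> (10 - s) * (s - 2) * s"
        using s False by simp
      ultimately show ?thesis
        using s False by (simp add: algebra_simps)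
    qed
    ultimately show ?thesis
      by (simp add: algebra_simps)
  qed
  have "1 / (8 * sqrt 2) * sqrt (real K * real T) \<le> 0.0884 * (s * T)"
    unfolding root using s sqrt_2_bound by (intro mult_right_mono) auto
  also have "\<dots> \<le> 0.99 / K * (T * (K - (T + 1) / 2))"
  proof -
    have "0.0884 * (s * T) * K = T * T * (0.0884 * s * (s * s))"
      by (simp flip: sT)
    also have "\<dots> \<le> T * T * (0.99 * (s * s) - 0.99 / 2 - 0.99 * (s * s) / (2 * K))"
      using poly by (intro mult_left_mono) auto
    also have "\<dots> = 0.99 * T * (s * s * T) - 0.99 / 2 * T * T - 0.99 * T * (s * s * T) / (2 * K)"
      by (simp add: algebra_simps)
    also have "\<dots> = 0.99 * (T * (K - (T + 1) / 2))"
      unfolding sT using K by (simp add: field_simps)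
    finally show ?thesis
      using K by (simp add: field_simps)
  qed
  also have "\<dots> = 99 / 100 * (1 - 0) / K * (\<Sum>t<T. real K - (1 + real t))"
    by (simp only: sum) simp
  also have "\<dots> \<le> (MAX k\<in>{..<K}. expected_regret (terminal_reward_instance (99 / 100) K (spike k 0 1)) \<pi> T)"
    by (rule max_regret_ge) (use K pol in \<open>auto intro!: sum_choice_sparse\<close>)
  finally show ?thesis .
qed

text \<open>The gap \<open>\<epsilon>\<close> is of order \<open>sqrt (K / T)\<close>, so that the
  information gathered in \<open>T\<close> epochs leaves a fixed fraction of them, at least 0.24,
  away from the good node on average over the instances.\<close>

lemma max_regret_dense:
  assumes K: "2 \<le> K" "K < T" and pol: "is_policy K \<pi>"
    and \<epsilon>: "\<epsilon> = 3 / 8 * sqrt (real K / real T)"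
  shows "1 / (8 * sqrt 2) * sqrt (real K * real T) \<le>
    (MAX k\<in>{..<K}. expected_regret (terminal_reward_instance (99 / 100) K (spike k ((1 - \<epsilon>) / 2) ((1 + \<epsilon>) / 2))) \<pi> T)"
proof -
  let ?a = "(1 - \<epsilon>) / 2" and ?b = "(1 + \<epsilon>) / 2"
  let ?I = "\<lambda>k. terminal_reward_instance (99 / 100) K (spike k ?a ?b)"
  let ?L = "ln ((1 + \<epsilon>) / (1 - \<epsilon>))"
  have T: "0 < T"
    using K by auto
  have \<epsilon>01: "0 < \<epsilon>" "\<epsilon> \<le> 3 / 8"
    using K T unfolding \<epsilon> by (auto simp: divide_simps)
  have L: "0 \<le> ?L" "?L \<le> 2 * (1.04)\<^sup>2 * \<epsilon>"
    using \<epsilon>01 ln_ratio_le[of \<epsilon>] by auto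
  \<comment> \<open>As \<open>?a + ?b = 1\<close>, the two logarithms are opposite and the relative
    entropy is \<open>(?b - ?a) * ?L\<close>.\<close>
  have kl: "?a * ln (?a / ?b) + (1 - ?a) * ln ((1 - ?a) / (1 - ?b)) = \<epsilon> * ?L"
  proof -
    have "1 - ?a = ?b" "1 - ?b = ?a" "?a / ?b = (1 - \<epsilon>) / (1 + \<epsilon>)" "?b / ?a = (1 + \<epsilon>) / (1 - \<epsilon>)"
      using \<epsilon>01 by (simp_all add: field_simps)
    then show ?thesis
      using \<epsilon>01 by (simp only:) (simp add: ln_div field_simps)
  qed
  define c where "c = sqrt (\<epsilon> * ?L / (2 * K))"
  have choice: "(\<Sum>k<K. expect (history_law (?I k) \<pi> t) (\<lambda>hist. pmf (\<pi> hist) k)) \<le> 1 + K * (c * sqrt t)" for t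
  proof -
    have "(\<Sum>k<K. expect (history_law (?I k) \<pi> t) (\<lambda>hist. pmf (\<pi> hist) k)) \<le> 1 + K * sqrt ((t * (\<epsilon> * ?L) / K) / 2)"
    proof (rule le_sqrt_of_forall_pos)
      fix \<mu> :: real
      assume "0 < \<mu>"
      then have "(\<Sum>k<K. expect (history_law (?I k) \<pi> t) (\<lambda>hist. pmf (\<pi> hist) k)) \<le> 1 + K * \<mu> / 2 + t * (\<epsilon> * ?L) / (4 * \<mu>)"
        using \<epsilon>01 K pol unfolding kl[symmetric] by (intro sum_choice_le_kl) (auto simp: field_simps)
      then show "(\<Sum>k<K. expect (history_law (?I k) \<pi> t) (\<lambda>hist. pmf (\<pi> hist) k)) \<le>
          1 + K * \<mu> / 2 + K * (t * (\<epsilon> * ?L) / K) / (4 * \<mu>)"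
        using K by simp
    qed (use \<epsilon>01 L K in auto)
    also have "sqrt ((t * (\<epsilon> * ?L) / K) / 2) = c * sqrt t"
      by (simp add: c_def mult_ac flip: real_sqrt_mult)
    finally show ?thesis .
  qed
  have c: "c \<le> 1.04 * \<epsilon> / sqrt K"
  proof -
    have "\<epsilon> * ?L / (2 * K) \<le> \<epsilon> * (2 * (1.04)\<^sup>2 * \<epsilon>) / (2 * K)"
      using \<epsilon>01 L by (intro divide_right_mono mult_left_mono) auto
    also have "\<dots> = (1.04 * \<epsilon> / sqrt K)\<^sup>2"
      using K by (simp add: power_divide power_mult_distrib power2_eq_square)
    finally show ?thesis
      unfolding c_def using \<epsilon>01 by (intro real_le_lsqrt) auto
  qed
  have \<epsilon>T: "\<epsilon> * T = 3 / 8 * sqrt (real K * real T)"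
    using T unfolding \<epsilon> by (simp add: real_sqrt_divide real_sqrt_mult field_simps)
  have \<epsilon>s: "\<epsilon> / sqrt K * sqrt T = 3 / 8"
    using T K unfolding \<epsilon> by (simp add: real_sqrt_divide)
  \<comment> \<open>The constant is \<open>1.04 * (2 / 3) * (3 / 8) = 0.26\<close>.\<close>
  have csum: "c * (\<Sum>t<T. sqrt t) \<le> 0.26 * T"
  proof -
    have "c * (\<Sum>t<T. sqrt t) \<le> (1.04 * \<epsilon> / sqrt K) * (2 / 3 * (T * sqrt T))"
      using \<epsilon>01 by (intro mult_mono c sum_sqrt_le sum_nonneg) auto
    also have "\<dots> = 1.04 * (2 / 3) * T * (\<epsilon> / sqrt K * sqrt T)"
      by simp
    also have "\<dots> = 0.26 * T"
      unfolding \<epsilon>s by simp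
    finally show ?thesis .
  qed
  \<comment> \<open>The fraction 0.24 is \<open>1 - 1 / 2 - 0.26\<close>, with
    \<open>1 / K \<le> 1 / 2\<close>. The product \<open>0.99 * (3 / 8) * 0.24 = 0.0891\<close>
    barely exceeds 0.0884.\<close>
  have "1 / (8 * sqrt 2) * sqrt (real K * real T) \<le> 0.99 * (3 / 8) * 0.24 * sqrt (real K * real T)"
    using sqrt_2_bound by (intro mult_right_mono) auto
  also have "\<dots> = 0.99 * \<epsilon> * (0.24 * T)"
    using \<epsilon>T by simp
  also have "\<dots> \<le> 0.99 * \<epsilon> * (T - T / K - c * (\<Sum>t<T. sqrt t))"
  proof (rule mult_left_mono)
    have "T / K \<le> T / 2"
      using K by (intro divide_left_mono) auto
    then show "0.24 * T \<le> T - T / K - c * (\<Sum>t<T. sqrt t)"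
      using csum by simp
  qed (use \<epsilon>01 in auto)
  also have "\<dots> = 99 / 100 * (?b - ?a) / K * (\<Sum>t<T. real K - (1 + K * (c * sqrt t)))"
    using K by (simp add: sum_subtractf sum.distrib field_simps flip: sum_distrib_left)
  also have "\<dots> \<le> (MAX k\<in>{..<K}. expected_regret (?I k) \<pi> T)"
    by (rule max_regret_ge) (use K pol \<epsilon>01 choice in auto)
  finally show ?thesis .
qed

section \<open>Common structure of the instances, and assembly of the two regimes\<close>

lemma terminal_reward_instance_structure:
  fixes h :: real and q :: "nat \<Rightarrow> real"
  assumes h: "0 < h" "h < 1" and K: "0 < K"
  defines "I \<equiv> terminal_reward_instance h K q"
  shows "wf_instance I"
    and "primitive_mat (trans_mat I)" and "norm_inf (trans_mat I) = 1 - h"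
proof -
  have M: "trans_mat I = mat K K (\<lambda>_. (1 - h) / K)"
    unfolding trans_mat_def I_def
    by (intro eq_matI) (simp_all add: trans_prob_def pmf_uniform_step[OF h K])
  show "wf_instance I"
    using K set_uniform_step[OF h K] by (auto simp: wf_instance_def I_def)
  show "primitive_mat (trans_mat I)"
    using h K unfolding primitive_mat_def M by (auto intro!: exI[of _ 1])
  have "(\<lambda>i. \<Sum>j<K. \<bar>trans_mat I $$ (i, j)\<bar>) ` {..<K} = {1 - h}"
    using h K by (auto simp: M)
  then show "norm_inf (trans_mat I) = 1 - h"
    by (simp add: norm_inf_def M)
qed

text \<open>For \<open>K = 1\<close> the regret vanishes. With the prescribed transitions, mean
  rewards differ by at most 1, so the regret is at most \<open>T\<close>, and a bound with this
  constant forces \<open>K \<le> 128 * T\<close>.\<close>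

theorem theorem2:
  "\<exists>h::real. 0 < h \<and> h < 1 \<and>
     (\<forall>K T :: nat. 2 \<le> K \<and> K \<le> 100 * T \<longrightarrow>
       (\<exists>\<JJ> :: nat \<Rightarrow> rw_instance.
          (\<forall>k<K. wf_instance (\<JJ> k) \<and> nodes (\<JJ> k) = K) \<and>
          (\<exists>p>0. 1 - real K * p = h \<and>
             (\<forall>k<K. \<forall>i<K. (\<forall>j<K. trans_prob (\<JJ> k) i (Some j) = p) \<and>
                               trans_prob (\<JJ> k) i None = h)) \<and>
          (\<forall>k<K. primitive_mat (trans_mat (\<JJ> k)) \<and>
                  norm_inf (trans_mat (\<JJ> k)) = 1 - h) \<and>
          (\<forall>\<pi>. is_policy K \<pi> \<longrightarrow>
             (MAX k\<in>{..<K}. expected_regret (\<JJ> k) \<pi> T)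
               \<ge> 1 / (8 * sqrt 2) * sqrt (real K * real T))))"
proof (intro exI[of _ "99 / 100 :: real"] conjI allI impI)
  \<comment> \<open>The value must satisfy \<open>0.0884 \<le> ?h * (3 / 8) * 0.24\<close> for the
    case \<open>K < T\<close>.\<close>
  let ?h = "99 / 100 :: real"
  show "0 < ?h" "?h < 1"
    by simp_all
  fix K T :: nat
  assume KT: "2 \<le> K \<and> K \<le> 100 * T"
  then have K: "0 < K"
    by simp
  define \<epsilon> where "\<epsilon> = 3 / 8 * sqrt (real K / real T)"
  define q where "q k = (if T \<le> K then spike k 0 1 else spike k ((1 - \<epsilon>) / 2) ((1 + \<epsilon>) / 2))" for k
  let ?J = "\<lambda>k. terminal_reward_instance ?h K (q k)"
  have h: "0 < ?h" "?h < 1"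
    by simp_all
  note struct = terminal_reward_instance_structure[OF h K]
  have "(MAX k\<in>{..<K}. expected_regret (?J k) \<pi> T) \<ge> 1 / (8 * sqrt 2) * sqrt (real K * real T)"
    if "is_policy K \<pi>" for \<pi>
  proof (cases "T \<le> K")
    case True
    then show ?thesis
      using max_regret_sparse[of K T \<pi>] KT that by (simp add: q_def)
  next
    case False
    then show ?thesis
      using max_regret_dense[of K T \<pi> \<epsilon>] KT that by (simp add: q_def \<epsilon>_def)
  qed
  moreover have "\<exists>p>0. 1 - real K * p = ?h \<and>
      (\<forall>k<K. \<forall>i<K. (\<forall>j<K. trans_prob (?J k) i (Some j) = p) \<and> trans_prob (?J k) i None = ?h)"
    using K by (intro exI[of _ "(1 - ?h) / K"]) (simp add: trans_prob_def pmf_uniform_step[OF h K])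
  ultimately show "\<exists>\<JJ> :: nat \<Rightarrow> rw_instance.
          (\<forall>k<K. wf_instance (\<JJ> k) \<and> nodes (\<JJ> k) = K) \<and>
          (\<exists>p>0. 1 - real K * p = ?h \<and>
             (\<forall>k<K. \<forall>i<K. (\<forall>j<K. trans_prob (\<JJ> k) i (Some j) = p) \<and>
                               trans_prob (\<JJ> k) i None = ?h)) \<and>
          (\<forall>k<K. primitive_mat (trans_mat (\<JJ> k)) \<and>
                  norm_inf (trans_mat (\<JJ> k)) = 1 - ?h) \<and>
          (\<forall>\<pi>. is_policy K \<pi> \<longrightarrow>
             (MAX k\<in>{..<K}. expected_regret (\<JJ> k) \<pi> T)
               \<ge> 1 / (8 * sqrt 2) * sqrt (real K * real T))"
    using struct by (intro exI[of _ ?J]) simp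
qed

end
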